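(* Let $\lambda>0$, and consider the family $\mathcal F=\{f_\theta(\cdot\mid x)=\mathcal N(\langle\theta,x\rangle,1):\theta\in\mathbb R^d\}$. Given a sample $(X_1,Y_1),\dots,(X_n,Y_n)\in\mathbb R^d\times\mathbb R$, the penalized Sample Minmax Predictor with penalty $\phi(\theta)=\frac\lambda2\|\theta\|^2$ is well defined and equals $\widetilde f_{\lambda,n}(\cdot\mid x)=\mathcal N(\widetilde\mu_\lambda(x),\widetilde\sigma_\lambda^2(x))$, where $$\widetilde\sigma_\lambda(x)^2=\Big(\big(1-\|x\|^2_{\widehat K_\lambda^x}\big)^2+\lambda\|x\|^2_{(\widehat K_\lambda^x)^2}\Big)^{-1},\qquad \widetilde\mu_\lambda(x)=\langle\widehat\theta_{\lambda',n},x\rangle-\lambda\,\widetilde\sigma_\lambda(x)^2\,\langle\widehat\theta_{\lambda',n},x\rangle_{\widehat K_\lambda^x}.$$ In addition, if $(X,Y),(X_1,Y_1),\dots,(X_n,Y_n)$ are i.i.d. with $\mathbb E\|X\|^2<+\infty$, $\mathbb E[Y^2]<+\infty$ and $\|X\|\le R$ almost surely for some constant $R>0$, then for every $\lambda\ge 2R^2/(n+1)$, $$\mathbb E\big[\mathcal R(\widetilde f_{\lambda,n})\big]-\inf_{\theta\in\mathbb R^d}\Big\{\mathcal R(f_\theta)+\frac\lambda2\|\theta\|^2\Big\}\le1.25\cdot\frac{\mathsf{df}_\lambda(\Sigma)}{n+1},$$ where $\Sigma=\mathbb E[XX^\top]$ and $\mathsf{df}_\lambda(\Sigma)=\operatorname{tr}[(\Sigma+\lambda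 I_d)^{-1}\Sigma]$.
   Context: Notation: for a symmetric positive semidefinite matrix $A$, $\langle u,v\rangle_A=\langle Au,v\rangle$ and $\|u\|_A^2=\langle Au,u\rangle$. $\widehat\Sigma_n=\frac1n\sum_{i=1}^nX_iX_i^\top$, $\widehat S_n=\frac1n\sum_{i=1}^nY_iX_i$, $\widehat K_\lambda^x=\big(n\widehat\Sigma_n+xx^\top+\lambda(n+1)I_d\big)^{-1}$, $\lambda'=\frac{n+1}n\lambda$, and $\widehat\theta_{\lambda',n}=(\widehat\Sigma_n+\lambda' I_d)^{-1}\widehat S_n$ (Ridge estimator). Densities are with respect to $\mu(dy)=(2\pi)^{-1/2}dy$, so $-\log f_\theta(y\mid x)=\frac12(y-\langle\theta,x\rangle)^2$. The risk of a conditional density $g$ is $\mathcal R(g)=\mathbb E[-\log g(Y\mid X)]$. The penalized Sample Minmax Predictor is $$\widetilde f_{\lambda,n}(y\mid x)=\frac{f_{\widehat\theta_{\lambda,n}^{(x,y)}}(y\mid x)\,e^{-\lambda\|\widehat\theta_{\lambda,n}^{(x,y)}\|^2/2}}{\int_{\mathbb R}f_{\widehat\theta_{\lambda,n}^{(x,y')}}(y'\mid x)\,e^{-\lambda\|\widehat\theta_{\lambda,n}^{(x,y')}\|^2/2}\mu(dy')},$$ where $\widehat\theta_{\lambda,n}^{(x,y)}=\operatorname{arg\,min}_{\theta\in\mathbb R^d}\big\{\sum_{i=1}^n\frac12(Y_i-\langle\theta,X_i\rangle)^2+\frac12(y-\langle\theta,x\rangle)^2+(n+1)\frac\lambda2\|\theta\|^2\big\}$.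 *)

theory Defs
  imports "HOL-Probability.Probability"
begin

definition base_measure :: "real measure" where
  "base_measure = density lborel (\<lambda>_. ennreal (1 / sqrt (2 * pi)))"

text \<open>Density of the normal law with mean \<open>m\<close> and \<^emph>\<open>variance\<close> \<open>v\<close> with respect to
  \<^const>\<open>base_measure\<close> (whereas \<^const>\<open>normal_density\<close> takes the standard deviation and is a density
  with respect to \<^const>\<open>lborel\<close>).\<close>

definition normal_dens :: "real \<Rightarrow> real \<Rightarrow> real \<Rightarrow> real" where
  "normal_dens m v y = sqrt (2 * pi) * normal_density m (sqrt v) y"

lemma density_normal_dens:
  "density base_measure (\<lambda>y. ennreal (normal_dens m v y)) =
   density lborel (\<lambda>y. ennreal (normal_density m (sqrt v) y))"
proof -
  have eq: "ennreal (1 / sqrt (2 * pi)) * ennreal (normal_dens m v y) =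
      ennreal (normal_density m (sqrt v) y)" for y
    unfolding normal_dens_def by (subst ennreal_mult[symmetric]) auto
  have [measurable]: "normal_dens m v \<in> borel_measurable borel"
    unfolding normal_dens_def[abs_def] by measurable
  show ?thesis
    unfolding base_measure_def by (subst density_density_eq) (auto simp: eq)
qed

text \<open>Conditional densities are functions of \<open>x\<close> first and \<open>y\<close> second: \<open>g x y\<close> stands for
  \<open>g(y | x)\<close>.\<close>

definition gauss_model :: "real ^ 'd \<Rightarrow> real ^ 'd \<Rightarrow> real \<Rightarrow> real" where
  "gauss_model \<theta> x y = normal_dens (\<theta> \<bullet> x) 1 y"

lemma neg_ln_gauss_model: "- ln (gauss_model \<theta> x y) = (y - \<theta> \<bullet> x)\<^sup>2 / 2"
proof -
  have "gauss_model \<theta> x y = exp (- ((y - \<theta> \<bullet> x)\<^sup>2 / 2))"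
    by (simp add: gauss_model_def normal_dens_def normal_density_def)
  thus ?thesis by simp
qed

definition risk ::
  "'w measure \<Rightarrow> ('w \<Rightarrow> real ^ 'd) \<Rightarrow> ('w \<Rightarrow> real) \<Rightarrow> (real ^ 'd \<Rightarrow> real \<Rightarrow> real) \<Rightarrow> real" where
  "risk M X Y g = (\<integral>\<omega>. - ln (g (X \<omega>) (Y \<omega>)) \<partial>M)"

text \<open>A sample of size \<open>n\<close> is a pair of sequences of which only the entries \<open>1, \<dots>, n\<close> are used.\<close>

definition pen_objective ::
  "real \<Rightarrow> nat \<Rightarrow> (nat \<Rightarrow> real ^ 'd) \<Rightarrow> (nat \<Rightarrow> real) \<Rightarrow> real ^ 'd \<Rightarrow> real \<Rightarrow> real ^ 'd \<Rightarrow> real" where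
  "pen_objective lam n X Y x y \<theta> =
     (\<Sum>i=1..n. (Y i - \<theta> \<bullet> X i)\<^sup>2 / 2) + (y - \<theta> \<bullet> x)\<^sup>2 / 2
     + (real n + 1) * (lam / 2) * (norm \<theta>)\<^sup>2"

definition pen_estimator ::
  "real \<Rightarrow> nat \<Rightarrow> (nat \<Rightarrow> real ^ 'd) \<Rightarrow> (nat \<Rightarrow> real) \<Rightarrow> real ^ 'd \<Rightarrow> real \<Rightarrow> real ^ 'd" where
  "pen_estimator lam n X Y x y = (ARG_MIN (pen_objective lam n X Y x y) \<theta>. True)"

definition smp_weight ::
  "real \<Rightarrow> nat \<Rightarrow> (nat \<Rightarrow> real ^ 'd) \<Rightarrow> (nat \<Rightarrow> real) \<Rightarrow> real ^ 'd \<Rightarrow> real \<Rightarrow> real" where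
  "smp_weight lam n X Y x y =
     gauss_model (pen_estimator lam n X Y x y) x y
     * exp (- (lam * (norm (pen_estimator lam n X Y x y))\<^sup>2 / 2))"

definition smp ::
  "real \<Rightarrow> nat \<Rightarrow> (nat \<Rightarrow> real ^ 'd) \<Rightarrow> (nat \<Rightarrow> real) \<Rightarrow> real ^ 'd \<Rightarrow> real \<Rightarrow> real" where
  "smp lam n X Y x y =
     smp_weight lam n X Y x y / (\<integral>y'. smp_weight lam n X Y x y' \<partial>base_measure)"

definition smp_well_defined ::
  "real \<Rightarrow> nat \<Rightarrow> (nat \<Rightarrow> real ^ 'd) \<Rightarrow> (nat \<Rightarrow> real) \<Rightarrow> real ^ 'd \<Rightarrow> bool" where
  "smp_well_defined lam n X Y x \<longleftrightarrow>
     (\<forall>y. \<exists>!\<theta>. is_arg_min (pen_objective lam n X Y x y) (\<lambda>_. True) \<theta>) \<and>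
     integrable base_measure (smp_weight lam n X Y x) \<and>
     (\<integral>y'. smp_weight lam n X Y x y' \<partial>base_measure) > 0"

definition inner_mat :: "real ^ 'd ^ 'd \<Rightarrow> real ^ 'd \<Rightarrow> real ^ 'd \<Rightarrow> real" where
  "inner_mat A u v = (A *v u) \<bullet> v"

definition sqnorm_mat :: "real ^ 'd ^ 'd \<Rightarrow> real ^ 'd \<Rightarrow> real" where
  "sqnorm_mat A u = inner_mat A u u"

definition outer :: "real ^ 'd \<Rightarrow> real ^ 'd ^ 'd" where
  "outer x = (\<chi> i j. x $ i * x $ j)"

definition emp_cov :: "nat \<Rightarrow> (nat \<Rightarrow> real ^ 'd) \<Rightarrow> real ^ 'd ^ 'd" where
  "emp_cov n X = (1 / real n) *\<^sub>R (\<Sum>i=1..n. outer (X i))"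

definition emp_cross :: "nat \<Rightarrow> (nat \<Rightarrow> real ^ 'd) \<Rightarrow> (nat \<Rightarrow> real) \<Rightarrow> real ^ 'd" where
  "emp_cross n X Y = (1 / real n) *\<^sub>R (\<Sum>i=1..n. Y i *\<^sub>R X i)"

definition K_mat :: "real \<Rightarrow> nat \<Rightarrow> (nat \<Rightarrow> real ^ 'd) \<Rightarrow> real ^ 'd \<Rightarrow> real ^ 'd ^ 'd" where
  "K_mat lam n X x =
     matrix_inv (real n *\<^sub>R emp_cov n X + outer x + (lam * (real n + 1)) *\<^sub>R mat 1)"

definition ridge :: "real \<Rightarrow> nat \<Rightarrow> (nat \<Rightarrow> real ^ 'd) \<Rightarrow> (nat \<Rightarrow> real) \<Rightarrow> real ^ 'd" where
  "ridge lam n X Y = matrix_inv (emp_cov n X + lam *\<^sub>R mat 1) *v emp_cross n X Y"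

definition smp_var :: "real \<Rightarrow> nat \<Rightarrow> (nat \<Rightarrow> real ^ 'd) \<Rightarrow> real ^ 'd \<Rightarrow> real" where
  "smp_var lam n X x =
     inverse ((1 - sqnorm_mat (K_mat lam n X x) x)\<^sup>2
              + lam * sqnorm_mat (K_mat lam n X x ** K_mat lam n X x) x)"

definition smp_mean ::
  "real \<Rightarrow> nat \<Rightarrow> (nat \<Rightarrow> real ^ 'd) \<Rightarrow> (nat \<Rightarrow> real) \<Rightarrow> real ^ 'd \<Rightarrow> real" where
  "smp_mean lam n X Y x =
     (let \<theta>' = ridge ((real n + 1) / real n * lam) n X Y
      in \<theta>' \<bullet> x - lam * smp_var lam n X x * inner_mat (K_mat lam n X x) \<theta>' x)"

definition cov_mat :: "'w measure \<Rightarrow> ('w \<Rightarrow> real ^ 'd) \<Rightarrow> real ^ 'd ^ 'd" where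
  "cov_mat M X = (\<integral>\<omega>. outer (X \<omega>) \<partial>M)"

definition deg_freedom :: "real \<Rightarrow> real ^ 'd ^ 'd \<Rightarrow> real" where
  "deg_freedom lam A = trace (matrix_inv (A + lam *\<^sub>R mat 1) ** A)"

end

theory Submission
  imports Defs
begin

text \<open>Substituting the closed form of the penalized estimator makes minus twice the logarithm of the
  unnormalized predictor a quadratic polynomial in \<open>y\<close> with leading coefficient \<open>1 / smp_var\<close>, which
  gives the Gaussian form. It is nonnegative, so the logarithm of the normalizing constant is at most
  \<open>ln smp_var / 2 \<le> - ln (1 - h)\<close>, where \<open>h\<close> is the regularized leverage of the test point among the
  \<open>n + 1\<close> points. Boundedness and the lower bound on \<open>lam\<close> force \<open>h \<le> 1/3\<close>, whence
  \<open>- ln (1 - h) \<le> 1.25 h\<close>.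

  By exchangeability, the expected unnormalized log loss at the test point is the expected average
  over all \<open>n + 1\<close> points, that is, the expected minimum of the regularized empirical risk, which is at
  most the regularized risk of any fixed \<open>\<theta>\<close>. Likewise \<open>(n + 1) E[h]\<close> is the expected sum of all leverages,
  which is the degrees of freedom of the empirical covariance of the \<open>n + 1\<close> points; concavity of this
  quantity in the covariance (Jensen) bounds it by the degrees of freedom of \<open>\<Sigma>\<close>.\<close>

subsection \<open>Regularized least squares\<close>

lemma matrix_inv_vector_cancel:
  fixes A :: "real ^ 'd ^ 'd"
  assumes "invertible A"
  shows "A *v (matrix_inv A *v v) = v" "matrix_inv A *v (A *v v) = v"
proof -
  have "A ** matrix_inv A = mat 1 \<and> matrix_inv A ** A = mat 1"
    using assms unfolding matrix_inv_def invertible_def by (rule someI_ex)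
  then show "A *v (matrix_inv A *v v) = v" "matrix_inv A *v (A *v v) = v"
    by (simp_all add: matrix_vector_mul_assoc)
qed

lemma invertible_pos_def:
  fixes A :: "real ^ 'd ^ 'd"
  assumes "\<And>v. v \<noteq> 0 \<Longrightarrow> 0 < (A *v v) \<bullet> v"
  shows "invertible A"
proof -
  have "\<forall>v. A *v v = 0 \<longrightarrow> v = 0"
    using assms by (metis inner_zero_left less_irrefl)
  then show ?thesis
    by (metis invertible_left_inverse matrix_left_invertible_ker)
qed

lemma outer_mult_vec: "outer x *v v = (x \<bullet> v) *\<^sub>R x"
  by (simp add: outer_def matrix_vector_mult_def vec_eq_iff inner_vec_def sum_distrib_left mult_ac)

lemma sum_matrix_vector_mult:
  fixes A :: "'i \<Rightarrow> real ^ 'd ^ 'd"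
  shows "(\<Sum>i\<in>I. A i) *v v = (\<Sum>i\<in>I. A i *v v)"
  by (induction I rule: infinite_finite_induct) (simp_all add: matrix_vector_mult_add_rdistrib)

text \<open>The penalty \<open>c\<close> is not scaled by the number of points and the index set is
  free: the same object serves the sample \<open>{1..n}\<close> and the augmented sample
  \<open>{0..n}\<close>, whose slot 0 holds the test point.\<close>

definition reg_gram :: "'i set \<Rightarrow> real \<Rightarrow> ('i \<Rightarrow> real ^ 'd) \<Rightarrow> real ^ 'd ^ 'd" where
  "reg_gram I c X = (\<Sum>i\<in>I. outer (X i)) + c *\<^sub>R mat 1"

definition reg_lsq :: "'i set \<Rightarrow> real \<Rightarrow> ('i \<Rightarrow> real ^ 'd) \<Rightarrow> ('i \<Rightarrow> real) \<Rightarrow> real ^ 'd" where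
  "reg_lsq I c X Y = matrix_inv (reg_gram I c X) *v (\<Sum>i\<in>I. Y i *\<^sub>R X i)"

definition reg_obj ::
  "'i set \<Rightarrow> real \<Rightarrow> ('i \<Rightarrow> real ^ 'd) \<Rightarrow> ('i \<Rightarrow> real) \<Rightarrow> real ^ 'd \<Rightarrow> real" where
  "reg_obj I c X Y \<theta> = (\<Sum>i\<in>I. (Y i - \<theta> \<bullet> X i)\<^sup>2 / 2) + c / 2 * (norm \<theta>)\<^sup>2"

text \<open>Diagonal entry of the ridge hat matrix. At the test point in slot 0, with
  \<open>c = lam * (real n + 1)\<close>, it is the squared norm of x with respect to
  \<open>K_mat\<close>.\<close>

definition leverage :: "'i set \<Rightarrow> real \<Rightarrow> ('i \<Rightarrow> real ^ 'd) \<Rightarrow> 'i \<Rightarrow> real" where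
  "leverage I c X i = X i \<bullet> (matrix_inv (reg_gram I c X) *v X i)"

lemma reg_gram_mult_vec:
  "reg_gram I c X *v v = (\<Sum>i\<in>I. (X i \<bullet> v) *\<^sub>R X i) + c *\<^sub>R v"
  by (simp add: reg_gram_def matrix_vector_mult_add_rdistrib sum_matrix_vector_mult outer_mult_vec
      flip: scaleR_matrix_vector_assoc)

lemma inner_reg_gram:
  "(reg_gram I c X *v v) \<bullet> w = (\<Sum>i\<in>I. (X i \<bullet> v) * (X i \<bullet> w)) + c * (v \<bullet> w)"
  by (simp add: reg_gram_mult_vec inner_add_left inner_sum_left)

lemma reg_gram_nonneg: "0 \<le> c \<Longrightarrow> 0 \<le> (reg_gram I c X *v v) \<bullet> v"
  by (simp add: inner_reg_gram sum_nonneg)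

lemma reg_gram_pos:
  assumes "0 < c" "v \<noteq> 0" shows "0 < (reg_gram I c X *v v) \<bullet> v"
proof -
  have "0 < c * (v \<bullet> v)" using assms by simp
  moreover have "0 \<le> (\<Sum>i\<in>I. (X i \<bullet> v) * (X i \<bullet> v))" by (simp add: sum_nonneg)
  ultimately show ?thesis unfolding inner_reg_gram by linarith
qed

lemma invertible_reg_gram: "0 < c \<Longrightarrow> invertible (reg_gram I c X)"
  by (intro invertible_pos_def reg_gram_pos)

lemmas reg_gram_inverse = matrix_inv_vector_cancel[OF invertible_reg_gram]

lemma reg_gram_sym: "(reg_gram I c X *v v) \<bullet> w = v \<bullet> (reg_gram I c X *v w)"
proof -
  have "(reg_gram I c X *v v) \<bullet> w = (reg_gram I c X *v w) \<bullet> v"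
    unfolding inner_reg_gram by (simp add: inner_commute mult.commute)
  then show ?thesis by (metis inner_commute)
qed

lemma reg_gram_inverse_sym:
  assumes "0 < c"
  shows "(matrix_inv (reg_gram I c X) *v v) \<bullet> w = v \<bullet> (matrix_inv (reg_gram I c X) *v w)"
  by (metis reg_gram_inverse(1)[OF assms] reg_gram_sym)

text \<open>Completing the square: the objective is quadratic with Hessian \<open>reg_gram\<close>,
  and its gradient vanishes at the solution of the normal equations. Positive definiteness of the
  Hessian then yields both existence and uniqueness of the minimizer.\<close>

lemma reg_obj_decomp:
  fixes I :: "'i set" and X :: "'i \<Rightarrow> real ^ 'd" and Y :: "'i \<Rightarrow> real"
  assumes "0 < c"
  defines "\<theta>0 \<equiv> reg_lsq I c X Y"
  shows "reg_obj I c X Y \<theta> =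
    reg_obj I c X Y \<theta>0 + (reg_gram I c X *v (\<theta> - \<theta>0)) \<bullet> (\<theta> - \<theta>0) / 2"
proof -
  define \<delta> where "\<delta> = \<theta> - \<theta>0"
  have normal_eq: "reg_gram I c X *v \<theta>0 = (\<Sum>i\<in>I. Y i *\<^sub>R X i)"
    by (simp add: \<theta>0_def reg_lsq_def reg_gram_inverse[OF assms(1)])
  \<comment> \<open>The normal equations tested against \<open>\<delta>\<close>; this makes the
    first-order term of the expansion vanish.\<close>
  have cross: "(\<Sum>i\<in>I. (Y i - \<theta>0 \<bullet> X i) * (\<delta> \<bullet> X i)) = c * (\<theta>0 \<bullet> \<delta>)"
  proof -
    have "(\<Sum>i\<in>I. Y i * (\<delta> \<bullet> X i)) = (\<Sum>i\<in>I. Y i *\<^sub>R X i) \<bullet> \<delta>"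
      unfolding inner_sum_left by (simp add: inner_commute)
    also have "\<dots> = (\<Sum>i\<in>I. (\<theta>0 \<bullet> X i) * (\<delta> \<bullet> X i)) + c * (\<theta>0 \<bullet> \<delta>)"
      unfolding normal_eq[symmetric] inner_reg_gram by (simp add: inner_commute)
    finally show ?thesis by (simp add: left_diff_distrib sum_subtractf)
  qed
  have sq: "(Y i - \<theta> \<bullet> X i)\<^sup>2 / 2 =
      (Y i - \<theta>0 \<bullet> X i)\<^sup>2 / 2 - (Y i - \<theta>0 \<bullet> X i) * (\<delta> \<bullet> X i) + (\<delta> \<bullet> X i)\<^sup>2 / 2" for i
    unfolding \<delta>_def by (simp add: inner_diff_left power2_eq_square field_simps)
  have nrm: "(norm \<theta>)\<^sup>2 = (norm \<theta>0)\<^sup>2 + 2 * (\<theta>0 \<bullet> \<delta>) + (norm \<delta>)\<^sup>2"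
    by (simp add: \<delta>_def power2_norm_eq_inner inner_diff_left inner_diff_right inner_commute)
  have quad: "(reg_gram I c X *v \<delta>) \<bullet> \<delta> = (\<Sum>i\<in>I. (\<delta> \<bullet> X i)\<^sup>2) + c * (norm \<delta>)\<^sup>2"
    unfolding inner_reg_gram power2_norm_eq_inner by (simp add: power2_eq_square inner_commute)
  have "reg_obj I c X Y \<theta> = reg_obj I c X Y \<theta>0 + ((\<Sum>i\<in>I. (\<delta> \<bullet> X i)\<^sup>2) + c * (norm \<delta>)\<^sup>2) / 2"
    unfolding reg_obj_def sq nrm
    by (simp only: sum.distrib sum_subtractf cross sum_divide_distrib[symmetric])
       (simp add: field_simps)
  then show ?thesis by (simp add: quad flip: \<delta>_def)
qed

lemma reg_obj_minimal:
  "0 < c \<Longrightarrow> reg_obj I c X Y (reg_lsq I c X Y) \<le> reg_obj I c X Y \<theta>"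
  using reg_obj_decomp[of c I X Y \<theta>] reg_gram_nonneg[of c I X "\<theta> - reg_lsq I c X Y"] by simp

lemma is_arg_min_reg_obj_iff:
  assumes "0 < c"
  shows "is_arg_min (reg_obj I c X Y) (\<lambda>_. True) \<theta> \<longleftrightarrow> \<theta> = reg_lsq I c X Y"
proof
  assume "is_arg_min (reg_obj I c X Y) (\<lambda>_. True) \<theta>"
  then have "reg_obj I c X Y \<theta> \<le> reg_obj I c X Y (reg_lsq I c X Y)"
    by (simp add: is_arg_min_linorder)
  then show "\<theta> = reg_lsq I c X Y"
    using reg_obj_decomp[OF assms, of I X Y \<theta>]
      reg_gram_pos[OF assms, of "\<theta> - reg_lsq I c X Y" I X] by fastforce
qed (simp add: is_arg_min_linorder reg_obj_minimal assms)

text \<open>With B the regularized Gram matrix, the sum is the trace of B^-1 (B - c I), that is, d -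
  c tr(B^-1). Only the inverse remains random in this form, so convexity of the inverse can be
  applied to it later.\<close>

lemma sum_leverage:
  fixes X :: "'i \<Rightarrow> real ^ 'd"
  assumes "0 < c"
  shows "(\<Sum>i\<in>I. leverage I c X i) =
    real CARD('d) - c * (\<Sum>j\<in>UNIV. axis j 1 \<bullet> (matrix_inv (reg_gram I c X) *v axis j 1))"
proof -
  define K where "K = matrix_inv (reg_gram I c X)"
  have "leverage I c X i = (\<Sum>j\<in>UNIV. (X i \<bullet> (K *v axis j 1)) * (X i \<bullet> axis j 1))" for i
  proof -
    have "X i \<bullet> (K *v axis j 1) = (K *v X i) $ j" for j
      using reg_gram_inverse_sym[OF assms, of I X "X i" "axis j 1"]
      by (simp add: K_def inner_axis)
    then show ?thesis
      by (simp add: leverage_def K_def[symmetric] inner_vec_def[of "X i" "K *v X i"] inner_axis mult.commute)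
  qed
  then have "(\<Sum>i\<in>I. leverage I c X i) =
      (\<Sum>j\<in>UNIV. \<Sum>i\<in>I. (X i \<bullet> (K *v axis j 1)) * (X i \<bullet> axis j 1))"
    by (simp add: sum.swap[of _ I])
  also have "\<dots> = (\<Sum>j\<in>UNIV. 1 - c * (axis j 1 \<bullet> (K *v axis j 1)))"
  proof (intro sum.cong refl)
    fix j :: 'd
    show "(\<Sum>i\<in>I. (X i \<bullet> (K *v axis j 1)) * (X i \<bullet> axis j 1)) = 1 - c * (axis j 1 \<bullet> (K *v axis j 1))"
      using inner_reg_gram[of I c X "K *v axis j 1" "axis j 1"]
      by (simp add: K_def reg_gram_inverse[OF assms] inner_axis_axis inner_commute)
  qed
  finally show ?thesis by (simp add: sum_subtractf K_def flip: sum_distrib_left)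
qed

text \<open>For u = B^-1 x_i, the leverage x_i . u equals (B u) . u, the sum of all (x_k . u)^2 plus
  c |u|^2. Keeping only k = i in the sum gives the first inequality. Its penalty term is retained
  because it drives both the variance bound and the bound 1/3 below.\<close>

lemma leverage_bounds:
  assumes "0 < c" "finite I" "i \<in> I"
  shows "(leverage I c X i)\<^sup>2 + c * (norm (matrix_inv (reg_gram I c X) *v X i))\<^sup>2 \<le> leverage I c X i"
    and "0 \<le> leverage I c X i" and "leverage I c X i \<le> 1"
proof -
  define u where "u = matrix_inv (reg_gram I c X) *v X i"
  have "(X i \<bullet> u)\<^sup>2 \<le> (\<Sum>k\<in>I. (X k \<bullet> u)\<^sup>2)"
    using assms by (intro member_le_sum) auto
  moreover have "X i \<bullet> u = (\<Sum>k\<in>I. (X k \<bullet> u)\<^sup>2) + c * (norm u)\<^sup>2"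
    using inner_reg_gram[of I c X u u]
    by (simp add: u_def reg_gram_inverse[OF assms(1)] power2_eq_square dot_square_norm)
  ultimately show *: "(leverage I c X i)\<^sup>2 + c * (norm (matrix_inv (reg_gram I c X) *v X i))\<^sup>2
      \<le> leverage I c X i"
    by (simp add: leverage_def u_def)
  have "0 \<le> c * (norm (matrix_inv (reg_gram I c X) *v X i))\<^sup>2"
    using assms by simp
  then have sq: "(leverage I c X i)\<^sup>2 \<le> leverage I c X i" using * by linarith
  then show "0 \<le> leverage I c X i" by (rule order_trans[OF zero_le_power2])
  show "leverage I c X i \<le> 1"
  proof (rule ccontr)
    assume "\<not> leverage I c X i \<le> 1"
    then have "leverage I c X i * 1 < leverage I c X i * leverage I c X i"
      by (intro mult_strict_left_mono) auto
    with sq show False by (simp add: power2_eq_square)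
  qed
qed

text \<open>Cauchy-Schwarz gives h \<le> R |u|, so c |u|^2 \<ge> 2 R^2 |u|^2 \<ge> 2 h^2. Inserted
  into h^2 + c |u|^2 \<le> h this leaves 3 h^2 \<le> h.\<close>

lemma leverage_le_third:
  assumes "0 < c" "finite I" "i \<in> I" "norm (X i) \<le> R" "2 * R\<^sup>2 \<le> c"
  shows "leverage I c X i \<le> 1 / 3"
proof -
  define u where "u = matrix_inv (reg_gram I c X) *v X i"
  define h where "h = leverage I c X i"
  have h: "h\<^sup>2 + c * (norm u)\<^sup>2 \<le> h" "0 \<le> h"
    unfolding h_def u_def by (rule leverage_bounds[OF assms(1-3)])+
  have "h \<le> norm (X i) * norm u"
    unfolding h_def leverage_def u_def[symmetric] by (rule norm_cauchy_schwarz)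
  also have "\<dots> \<le> R * norm u" by (intro mult_right_mono assms) simp
  finally have "h\<^sup>2 \<le> (R * norm u)\<^sup>2" using h by (intro power_mono)
  also have "2 * (R * norm u)\<^sup>2 \<le> c * (norm u)\<^sup>2"
    using mult_right_mono[OF assms(5), of "(norm u)\<^sup>2"] by (simp add: power_mult_distrib)
  finally have "3 * h\<^sup>2 \<le> h" using h by linarith
  then show ?thesis unfolding h_def[symmetric] using h(2)
    by (cases "h = 0") (auto simp: power2_eq_square)
qed

subsection \<open>Closed form of the predictor\<close>

lemma sum_atLeast0_split:
  "(\<Sum>i\<in>{0..n}. f i) = f 0 + (\<Sum>i=1..n. f (i::nat))"
  by (simp add: sum.atLeast_Suc_atMost)

lemma pen_objective_eq_reg_obj:
  "pen_objective lam n X Y x y = reg_obj {0..n} (lam * (real n + 1)) (X(0 := x)) (Y(0 := y))"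
proof
  fix \<theta>
  show "pen_objective lam n X Y x y \<theta> =
      reg_obj {0..n} (lam * (real n + 1)) (X(0 := x)) (Y(0 := y)) \<theta>"
    unfolding pen_objective_def reg_obj_def sum_atLeast0_split
    by (simp add: algebra_simps)
qed

lemma pen_estimator_eq_reg_lsq:
  assumes "lam > 0"
  shows "pen_estimator lam n X Y x y =
    reg_lsq {0..n} (lam * (real n + 1)) (X(0 := x)) (Y(0 := y))"
proof -
  have "0 < lam * (real n + 1)" using assms by (simp add: add_nonneg_pos)
  then have "is_arg_min (pen_objective lam n X Y x y) (\<lambda>_. True) =
      (\<lambda>\<theta>. \<theta> = reg_lsq {0..n} (lam * (real n + 1)) (X(0 := x)) (Y(0 := y)))"
    by (simp add: fun_eq_iff is_arg_min_reg_obj_iff pen_objective_eq_reg_obj)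
  then show ?thesis
    unfolding pen_estimator_def arg_min_def by simp
qed

lemma K_mat_eq:
  assumes "n \<ge> 1"
  shows "K_mat lam n X x = matrix_inv (reg_gram {0..n} (lam * (real n + 1)) (X(0 := x)))"
  using assms unfolding K_mat_def emp_cov_def reg_gram_def sum_atLeast0_split
  by (simp add: add.commute)

text \<open>Multiplying the normal equations for the penalty \<lambda>' by \<open>real n\<close>
  turns the penalty into \<open>lam * (real n + 1)\<close>, the same as for the augmented sample.
  The two Gram matrices then differ by \<open>outer x\<close> alone.\<close>

lemma reg_gram_ridge:
  fixes X :: "nat \<Rightarrow> real ^ 'd"
  assumes "lam > 0" "n \<ge> 1"
  shows "reg_gram {1..n} (lam * (real n + 1)) X *v ridge ((real n + 1) / real n * lam) n X Y =
    (\<Sum>i=1..n. Y i *\<^sub>R X i)"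
proof -
  define c where "c = lam * (real n + 1)"
  define A where "A = emp_cov n X + ((real n + 1) / real n * lam) *\<^sub>R (mat 1 :: real ^ 'd ^ 'd)"
  have A: "A = (1 / real n) *\<^sub>R reg_gram {1..n} c X"
  proof -
    have "(real n + 1) / real n * lam = 1 / real n * c" by (simp add: c_def)
    then show ?thesis by (simp add: A_def emp_cov_def reg_gram_def scaleR_add_right)
  qed
  have "0 < c" using assms by (simp add: c_def)
  then have "invertible (reg_gram {1..n} c X)" by (rule invertible_reg_gram)
  then have "invertible A" unfolding A using assms by (intro scalar_invertible) auto
  then have "A *v ridge ((real n + 1) / real n * lam) n X Y = emp_cross n X Y"
    unfolding ridge_def A_def[symmetric] by (rule matrix_inv_vector_cancel)
  then have "(1 / real n) *\<^sub>R (reg_gram {1..n} c X *v ridge ((real n + 1) / real n * lam) n X Y) =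
      (1 / real n) *\<^sub>R (\<Sum>i=1..n. Y i *\<^sub>R X i)"
    unfolding A emp_cross_def scaleR_matrix_vector_assoc .
  then show ?thesis using assms unfolding c_def by simp
qed

text \<open>Minus twice the logarithm of the unnormalized predictor. The penalty carries
  \<open>lam\<close>, the share of one point in the total \<open>lam * (real n + 1)\<close>.\<close>

definition smp_energy ::
  "real \<Rightarrow> nat \<Rightarrow> (nat \<Rightarrow> real ^ 'd) \<Rightarrow> (nat \<Rightarrow> real) \<Rightarrow> real ^ 'd \<Rightarrow> real \<Rightarrow> real" where
  "smp_energy lam n X Y x y =
     (y - pen_estimator lam n X Y x y \<bullet> x)\<^sup>2 + lam * (norm (pen_estimator lam n X Y x y))\<^sup>2"

lemma smp_weight_eq: "smp_weight lam n X Y x y = exp (- smp_energy lam n X Y x y / 2)"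
  by (simp add: smp_weight_def smp_energy_def gauss_model_def normal_dens_def normal_density_def
      exp_add[symmetric] add_divide_distrib)

lemma smp_energy_nonneg: "lam > 0 \<Longrightarrow> 0 \<le> smp_energy lam n X Y x y"
  by (simp add: smp_energy_def)

text \<open>Symmetry of K turns the quadratic form of K^2 at x into |K x|^2.\<close>

lemma inverse_smp_var:
  fixes X :: "nat \<Rightarrow> real ^ 'd"
  assumes "lam > 0" "n \<ge> 1"
  shows "inverse (smp_var lam n X x) =
    (1 - leverage {0..n} (lam * (real n + 1)) (X(0 := x)) 0)\<^sup>2
    + lam * (norm (matrix_inv (reg_gram {0..n} (lam * (real n + 1)) (X(0 := x))) *v x))\<^sup>2"
proof -
  have c: "0 < lam * (real n + 1)" using assms by simp
  show ?thesis
    unfolding smp_var_def sqnorm_mat_def inner_mat_def K_mat_eq[OF assms(2)] leverage_def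
    by (simp add: inner_commute reg_gram_inverse_sym[OF c] power2_norm_eq_inner
        flip: matrix_vector_mul_assoc)
qed

text \<open>With u = K x the inverse variance is (1 - h)^2 + lam |u|^2. Since lam |u|^2 \<le> lam (n
  + 1) |u|^2 \<le> h - h^2, it is at most 1 - h \<le> 1. It is positive because u = 0 forces h = 0,
  in which case the first square is 1.\<close>

lemma smp_var_bounds:
  fixes X :: "nat \<Rightarrow> real ^ 'd"
  assumes "lam > 0" "n \<ge> 1"
  shows smp_var_pos: "smp_var lam n X x > 0"
    and smp_var_ge_1: "smp_var lam n X x \<ge> 1"
    and inverse_smp_var_ge:
      "(1 - leverage {0..n} (lam * (real n + 1)) (X(0 := x)) 0)\<^sup>2 \<le> inverse (smp_var lam n X x)"
proof -
  define h where "h = leverage {0..n} (lam * (real n + 1)) (X(0 := x)) 0"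
  define u where "u = matrix_inv (reg_gram {0..n} (lam * (real n + 1)) (X(0 := x))) *v x"
  have c: "0 < lam * (real n + 1)" using assms by simp
  have h: "h\<^sup>2 + lam * (real n + 1) * (norm u)\<^sup>2 \<le> h" "0 \<le> h" "h \<le> 1"
    using leverage_bounds[OF c, of "{0..n}" 0 "X(0 := x)"] by (simp_all add: h_def u_def)
  have inv: "inverse (smp_var lam n X x) = (1 - h)\<^sup>2 + lam * (norm u)\<^sup>2"
    unfolding h_def u_def by (rule inverse_smp_var[OF assms])
  show "(1 - h)\<^sup>2 \<le> inverse (smp_var lam n X x)"
    unfolding inv using assms by simp
  have pos: "0 < inverse (smp_var lam n X x)"
  proof (cases "u = 0")
    case True
    then have "h = 0" by (simp add: h_def leverage_def u_def)
    then show ?thesis using True inv by simp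
  next
    case False
    then have "0 < lam * (norm u)\<^sup>2" using assms by simp
    then show ?thesis unfolding inv by (simp add: add_nonneg_pos)
  qed
  then show "smp_var lam n X x > 0" by simp
  have "lam * (norm u)\<^sup>2 * 1 \<le> lam * (norm u)\<^sup>2 * (real n + 1)"
    using assms by (intro mult_left_mono) auto
  then have "inverse (smp_var lam n X x) \<le> (1 - h)\<^sup>2 + (h - h\<^sup>2)"
    unfolding inv using h(1) by (simp add: mult_ac)
  also have "\<dots> = 1 - h" by (simp add: power2_eq_square algebra_simps)
  also have "\<dots> \<le> 1" using h by simp
  finally show "smp_var lam n X x \<ge> 1" using pos
    by (simp add: inverse_le_1_iff)
qed

text \<open>The augmented estimator is affine in y, namely \<theta> + (y - p) u with \<theta> the
  ridge estimator at \<lambda>', p its prediction at x and u = K x. The residual is therefore (1 -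
  h) (y - p), and the energy is a quadratic polynomial in y with leading coefficient
  \<open>inverse (smp_var lam n X x)\<close> and vertex \<open>smp_mean\<close>.\<close>

lemma smp_energy_eq:
  fixes X :: "nat \<Rightarrow> real ^ 'd"
  fixes Y :: "nat \<Rightarrow> real" and x :: "real ^ 'd"
  assumes "lam > 0" "n \<ge> 1"
  defines "m \<equiv> smp_mean lam n X Y x"
  shows "smp_energy lam n X Y x y = (y - m)\<^sup>2 / smp_var lam n X x + smp_energy lam n X Y x m"
proof -
  define c where "c = lam * (real n + 1)"
  have c: "0 < c" using assms by (simp add: c_def)
  define B where "B = reg_gram {0..n} c (X(0 := x))"
  define K where "K = matrix_inv B"
  define b where "b = (\<Sum>i=1..n. Y i *\<^sub>R X i)"
  define \<theta> where "\<theta> = ridge ((real n + 1) / real n * lam) n X Y"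
  define u where "u = K *v x"
  define p where "p = \<theta> \<bullet> x"
  define h where "h = u \<bullet> x"
  define a where "a = inverse (smp_var lam n X x)"
  \<comment> \<open>Adding the test point with response p, which \<theta> fits exactly, does not
    move the minimizer: \<theta> solves the augmented normal equations for y = p.\<close>
  have B\<theta>: "B *v \<theta> = b + p *\<^sub>R x"
    using reg_gram_ridge[OF assms(1,2), of X Y]
    unfolding reg_gram_mult_vec B_def sum_atLeast0_split
    by (simp add: b_def p_def \<theta>_def c_def inner_commute algebra_simps)
  have "\<theta> = K *v (B *v \<theta>)" by (simp add: K_def B_def reg_gram_inverse[OF c])
  then have Kb: "K *v b = \<theta> - p *\<^sub>R u"
    by (simp add: B\<theta> matrix_vector_right_distrib matrix_vector_mult_scaleR u_def algebra_simps)
  have est: "pen_estimator lam n X Y x y = \<theta> + (y - p) *\<^sub>R u" for y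
  proof -
    have "pen_estimator lam n X Y x y = K *v (y *\<^sub>R x + b)"
      unfolding pen_estimator_eq_reg_lsq[OF assms(1)] reg_lsq_def sum_atLeast0_split
      by (simp add: K_def B_def c_def b_def)
    also have "\<dots> = \<theta> + (y - p) *\<^sub>R u"
      by (simp add: matrix_vector_right_distrib matrix_vector_mult_scaleR Kb u_def algebra_simps)
    finally show ?thesis .
  qed
  have a: "a = (1 - h)\<^sup>2 + lam * (u \<bullet> u)"
    unfolding a_def inverse_smp_var[OF assms(1,2)]
    by (simp add: h_def u_def K_def B_def c_def leverage_def inner_commute power2_norm_eq_inner)
  have a0: "a > 0" using smp_var_pos[OF assms(1,2)] by (simp add: a_def)
  have "m = p - lam * inverse a * (\<theta> \<bullet> u)"
    unfolding m_def smp_mean_def Let_def inner_mat_def K_mat_eq[OF assms(2)]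
    by (simp add: a_def p_def \<theta>_def u_def K_def B_def c_def[symmetric] reg_gram_inverse_sym[OF c])
  then have am: "a * m = a * p - lam * (\<theta> \<bullet> u)"
    using a0 by (simp add: right_diff_distrib mult.left_commute[of a])
  \<comment> \<open>The last summand is the energy at y = 0. The linear coefficient is -2
    \<open>a * m\<close>, which identifies m as the vertex.\<close>
  have E: "smp_energy lam n X Y x y =
      a * y\<^sup>2 - 2 * (a * m) * y + ((p - p * h)\<^sup>2 + lam * ((\<theta> - p *\<^sub>R u) \<bullet> (\<theta> - p *\<^sub>R u)))" for y
    unfolding smp_energy_def est power2_norm_eq_inner am
    unfolding a
    by (simp add: inner_add_left inner_add_right inner_diff_left inner_diff_right p_def[symmetric]
        h_def[symmetric] inner_commute[of u \<theta>] power2_eq_square algebra_simps)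
  have "smp_energy lam n X Y x y - smp_energy lam n X Y x m = a * (y - m)\<^sup>2"
    unfolding E by (simp add: power2_eq_square algebra_simps)
  then show ?thesis by (simp add: a_def divide_inverse algebra_simps)
qed

text \<open>The exponential of the completed square. The factor in front of
  \<open>normal_dens\<close> is the normalizing constant; it contains only
  \<open>sqrt (smp_var lam n X x)\<close> because the factor \<open>sqrt (2 * pi)\<close> is
  absorbed by the base measure.\<close>

lemma smp_weight_eq_normal_dens:
  fixes X :: "nat \<Rightarrow> real ^ 'd"
  assumes "lam > 0" "n \<ge> 1"
  shows "smp_weight lam n X Y x y =
    exp (- smp_energy lam n X Y x (smp_mean lam n X Y x) / 2) * sqrt (smp_var lam n X x)
    * normal_dens (smp_mean lam n X Y x) (smp_var lam n X x) y"
proof -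
  define s where "s = smp_var lam n X x"
  define m where "m = smp_mean lam n X Y x"
  define e where "e = smp_energy lam n X Y x m"
  have "sqrt s \<noteq> 0" "0 \<le> s" using smp_var_pos[OF assms, of X x] by (simp_all add: s_def)
  then have "sqrt s * normal_dens m s y = exp (- (y - m)\<^sup>2 / (2 * s))"
    by (simp add: normal_dens_def normal_density_def real_sqrt_mult)
  moreover have "exp (- ((y - m)\<^sup>2 / s + e) / 2) = exp (- e / 2) * exp (- (y - m)\<^sup>2 / (2 * s))"
    by (simp add: diff_divide_distrib flip: exp_add)
  ultimately show ?thesis
    unfolding smp_weight_eq smp_energy_eq[OF assms, of X Y x y] m_def[symmetric] s_def[symmetric]
      e_def[symmetric] by (simp add: mult.assoc)
qed

section \<open>Normalization of the predictor\<close>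

lemma base_measure_normal_dens:
  assumes "v > 0"
  shows "integrable base_measure (normal_dens m v)" "(\<integral>y. normal_dens m v y \<partial>base_measure) = 1"
proof -
  have [measurable]: "normal_dens m v \<in> borel_measurable borel"
    unfolding normal_dens_def[abs_def] by measurable
  have eq: "1 / sqrt (2 * pi) * normal_dens m v y = normal_density m (sqrt v) y" for y
    by (simp add: normal_dens_def)
  show "integrable base_measure (normal_dens m v)" "(\<integral>y. normal_dens m v y \<partial>base_measure) = 1"
    using assms unfolding base_measure_def
    by (subst integrable_density integral_density; simp add: eq del: times_divide_eq_left)+
qed

lemma smp_integral:
  fixes X :: "nat \<Rightarrow> real ^ 'd"
  assumes "lam > 0" "n \<ge> 1"
  shows "integrable base_measure (smp_weight lam n X Y x)"
    "(\<integral>y. smp_weight lam n X Y x y \<partial>base_measure) =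
     exp (- smp_energy lam n X Y x (smp_mean lam n X Y x) / 2) * sqrt (smp_var lam n X x)"
  using base_measure_normal_dens[OF smp_var_pos[OF assms, of X x]]
  unfolding smp_weight_eq_normal_dens[OF assms, abs_def] by simp_all

lemma smp_well_defined_pos:
  fixes X :: "nat \<Rightarrow> real ^ 'd"
  assumes "lam > 0" "n \<ge> 1"
  shows "smp_well_defined lam n X Y x"
proof -
  have "0 < lam * (real n + 1)" using assms by simp
  then show ?thesis
    using smp_integral[OF assms, of X Y x] smp_var_pos[OF assms, of X x]
    by (simp add: smp_well_defined_def pen_objective_eq_reg_obj is_arg_min_reg_obj_iff)
qed

lemma smp_eq_normal_dens:
  fixes X :: "nat \<Rightarrow> real ^ 'd"
  assumes "lam > 0" "n \<ge> 1"
  shows "smp lam n X Y x y = normal_dens (smp_mean lam n X Y x) (smp_var lam n X x) y"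
  using smp_var_pos[OF assms, of X x]
  unfolding smp_def smp_integral(2)[OF assms] smp_weight_eq_normal_dens[OF assms] by simp

section \<open>Bounds for the logarithmic loss\<close>

lemma neg_ln_normal_dens:
  assumes "v > 0" shows "- ln (normal_dens m v y) = (y - m)\<^sup>2 / (2 * v) + ln v / 2"
proof -
  have "normal_dens m v y = exp (- ((y - m)\<^sup>2 / (2 * v))) / sqrt v"
    using assms by (simp add: normal_dens_def normal_density_def real_sqrt_mult)
  then show ?thesis using assms by (simp add: ln_div ln_sqrt)
qed

text \<open>Equivalently, exp(-1.25 h) \<le> 1 - h. By convexity of exp it suffices to check the
  endpoints h = 0 and h = 1/3; at the latter the claim reads exp(-5/12) \<le> 2/3.\<close>

lemma neg_ln_le_of_le_third:
  assumes "0 \<le> h" "h \<le> 1 / 3" shows "- ln (1 - h) \<le> 1.25 * (h::real)"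
proof -
  \<comment> \<open>The quadratic Taylor bound just suffices: 1 + 5/12 + (5/12)^2 / 2 =
    433/288.\<close>
  have "3 / 2 \<le> exp (5 / 12 :: real)"
    using exp_lower_Taylor_quadratic[of "5 / 12 :: real"] by (simp add: power2_eq_square)
  then have e: "exp (- (5 / 12) :: real) \<le> 2 / 3"
    unfolding exp_minus using le_imp_inverse_le[of "3 / 2 :: real"] by simp
  have "exp ((1 - 3 * h) *\<^sub>R 0 + (3 * h) *\<^sub>R (- (5 / 12))) \<le>
      (1 - 3 * h) * exp 0 + (3 * h) * exp (- (5 / 12))"
    using assms by (intro convex_onD[OF exp_convex]) auto
  also have "\<dots> \<le> (1 - 3 * h) + (3 * h) * (2 / 3)"
    using e assms by (intro add_mono mult_left_mono) auto
  finally have "exp (- 1.25 * h) \<le> 1 - h" by simp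
  then have "- 1.25 * h \<le> ln (1 - h)" using assms by (simp only: ln_ge_iff)
  then show ?thesis by simp
qed

text \<open>The log of the normalizing constant of the predictor is at most \<open>ln (smp_var) / 2\<close>, as the
  energy is nonnegative at its minimum.\<close>

lemma neg_ln_smp_bounds:
  fixes X :: "nat \<Rightarrow> real ^ 'd"
  fixes x :: "real ^ 'd"
  assumes "lam > 0" "n \<ge> 1"
  defines "h \<equiv> leverage {0..n} (lam * (real n + 1)) (X(0 := x)) 0"
  shows neg_ln_smp_nonneg: "0 \<le> - ln (smp lam n X Y x y)"
    and neg_ln_smp_le:
      "h \<le> 1 / 3 \<Longrightarrow> - ln (smp lam n X Y x y) \<le> smp_energy lam n X Y x y / 2 + 1.25 * h"
proof -
  define s where "s = smp_var lam n X x"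
  define m where "m = smp_mean lam n X Y x"
  have s: "s \<ge> 1" "(1 - h)\<^sup>2 \<le> inverse s"
    unfolding s_def h_def by (rule smp_var_bounds[OF assms(1,2)])+
  have eq: "- ln (smp lam n X Y x y) = (y - m)\<^sup>2 / (2 * s) + ln s / 2"
    unfolding smp_eq_normal_dens[OF assms(1,2)] m_def s_def
    by (rule neg_ln_normal_dens[OF smp_var_pos[OF assms(1,2)]])
  show "0 \<le> - ln (smp lam n X Y x y)" unfolding eq using s by simp
  assume h1: "h \<le> 1 / 3"
  have h0: "0 \<le> h" unfolding h_def using assms by (intro leverage_bounds) auto
  have "2 * ln (1 - h) = ln ((1 - h)\<^sup>2)" using h1 by (simp add: ln_realpow)
  also have "\<dots> \<le> ln (inverse s)" using s h1 by (subst ln_le_cancel_iff) auto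
  also have "\<dots> = - ln s" using s by (simp add: ln_inverse)
  finally have "ln s / 2 \<le> 1.25 * h" using neg_ln_le_of_le_third[OF h0 h1] by simp
  moreover have "(y - m)\<^sup>2 / (2 * s) \<le> smp_energy lam n X Y x y / 2"
    using smp_energy_eq[OF assms(1,2), of X Y x y] smp_energy_nonneg[OF assms(1), of n X Y x m]
    by (simp add: s_def m_def)
  ultimately show "- ln (smp lam n X Y x y) \<le> smp_energy lam n X Y x y / 2 + 1.25 * h"
    unfolding eq by linarith
qed

subsection \<open>Measurability\<close>

lemma borel_measurable_vecI:
  fixes f :: "'a \<Rightarrow> 'b::euclidean_space ^ 'd"
  assumes "\<And>i. (\<lambda>a. f a $ i) \<in> borel_measurable M"
  shows "f \<in> borel_measurable M"
proof (rule borel_measurable_euclidean_space[THEN iffD2], rule ballI)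
  fix b :: "'b ^ 'd" assume "b \<in> Basis"
  then obtain i b' where "b = axis i b'" by (auto simp: Basis_vec_def)
  then show "(\<lambda>a. f a \<bullet> b) \<in> borel_measurable M" using assms[of i] by (simp add: inner_axis)
qed

lemma borel_measurable_vec_nth:
  fixes f :: "'a \<Rightarrow> real ^ 'd"
  assumes "f \<in> borel_measurable M" shows "(\<lambda>a. f a $ i) \<in> borel_measurable M"
  using borel_measurable_inner[OF assms borel_measurable_const, of "axis i 1"]
  by (simp add: inner_axis)

lemma borel_measurable_det:
  fixes A :: "'a \<Rightarrow> real ^ 'd ^ 'd"
  assumes "\<And>i j. (\<lambda>a. A a $ i $ j) \<in> borel_measurable M"
  shows "(\<lambda>a. det (A a)) \<in> borel_measurable M"
  unfolding det_def
  by (intro borel_measurable_sum borel_measurable_times borel_measurable_prod borel_measurable_const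
      assms)

text \<open>By Cramer's rule each coordinate is a quotient of determinants, and determinants are
  polynomials in the measurable entries.\<close>

lemma borel_measurable_matrix_inv_vector:
  fixes A :: "'a \<Rightarrow> real ^ 'd ^ 'd"
  assumes A: "\<And>i j. (\<lambda>a. A a $ i $ j) \<in> borel_measurable M"
    and v: "v \<in> borel_measurable M" and inv: "\<And>a. invertible (A a)"
  shows "(\<lambda>a. matrix_inv (A a) *v v a) \<in> borel_measurable M"
proof -
  have "matrix_inv (A a) *v v a =
      (\<chi> k. det (\<chi> i j. if j = k then v a $ i else A a $ i $ j) / det (A a))" for a
    by (subst cramer[symmetric])
       (use inv in \<open>simp_all add: invertible_det_nz[symmetric] matrix_inv_vector_cancel\<close>)
  moreover have "(\<lambda>a. det (\<chi> i j. if j = k then v a $ i else A a $ i $ j)) \<in> borel_measurable M" for k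
  proof (rule borel_measurable_det)
    fix i j
    show "(\<lambda>a. (\<chi> i j. if j = k then v a $ i else A a $ i $ j) $ i $ j) \<in> borel_measurable M"
      using A borel_measurable_vec_nth[OF v] by (cases "j = k") simp_all
  qed
  ultimately show ?thesis
    using borel_measurable_det[of A, OF A]
    by (intro borel_measurable_vecI) (simp add: borel_measurable_divide)
qed

lemma borel_measurable_reg_gram_inverse:
  assumes "0 < c" and X: "\<And>i. i \<in> I \<Longrightarrow> X i \<in> borel_measurable M"
    and v: "v \<in> borel_measurable M"
  shows "(\<lambda>a. matrix_inv (reg_gram I c (\<lambda>i. X i a)) *v v a) \<in> borel_measurable M"
proof (intro borel_measurable_matrix_inv_vector v invertible_reg_gram assms)
  fix j k
  have "reg_gram I c (\<lambda>i. X i a) $ j $ k = (\<Sum>i\<in>I. X i a $ j * X i a $ k) + c * mat 1 $ j $ k" for a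
    by (simp add: reg_gram_def outer_def)
  then show "(\<lambda>a. reg_gram I c (\<lambda>i. X i a) $ j $ k) \<in> borel_measurable M"
    by (auto intro!: borel_measurable_add borel_measurable_sum borel_measurable_times
        borel_measurable_vec_nth X)
qed

lemma borel_measurable_reg_lsq:
  assumes "0 < c" "\<And>i. i \<in> I \<Longrightarrow> X i \<in> borel_measurable M" "\<And>i. i \<in> I \<Longrightarrow> Y i \<in> borel_measurable M"
  shows "(\<lambda>a. reg_lsq I c (\<lambda>i. X i a) (\<lambda>i. Y i a)) \<in> borel_measurable M"
  unfolding reg_lsq_def
  by (intro borel_measurable_reg_gram_inverse borel_measurable_sum borel_measurable_scaleR assms)

lemma borel_measurable_leverage:
  assumes "0 < c" "\<And>i. i \<in> I \<Longrightarrow> X i \<in> borel_measurable M" "k \<in> I"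
  shows "(\<lambda>a. leverage I c (\<lambda>i. X i a) k) \<in> borel_measurable M"
  unfolding leverage_def
  by (intro borel_measurable_inner borel_measurable_reg_gram_inverse assms)

lemma ridge_eq_reg_lsq:
  assumes "lam > 0" "n \<ge> 1"
  shows "ridge ((real n + 1) / real n * lam) n X Y = reg_lsq {1..n} (lam * (real n + 1)) X Y"
proof -
  have "0 < lam * (real n + 1)" using assms by simp
  then show ?thesis
    unfolding reg_lsq_def reg_gram_ridge[OF assms, symmetric] by (simp add: reg_gram_inverse)
qed

text \<open>Measurability is read off the closed form, which involves only inverse Gram matrices
  applied to vectors; the definition itself hides it behind \<open>ARG_MIN\<close> and a
  parameter-dependent integral.\<close>

lemma borel_measurable_smp:
  fixes X :: "nat \<Rightarrow> 'a \<Rightarrow> real ^ 'd"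
  assumes pos: "lam > 0" "n \<ge> 1"
    and X: "\<And>i. i \<in> {1..n} \<Longrightarrow> X i \<in> borel_measurable M"
    and Y: "\<And>i. i \<in> {1..n} \<Longrightarrow> Y i \<in> borel_measurable M"
    and x [measurable]: "x \<in> borel_measurable M" and y [measurable]: "y \<in> borel_measurable M"
  shows "(\<lambda>a. smp lam n (\<lambda>i. X i a) (\<lambda>i. Y i a) (x a) (y a)) \<in> borel_measurable M"
proof -
  define c where "c = lam * (real n + 1)"
  define X' where "X' i a = (if i = 0 then x a else X i a)" for i a
  define \<theta> where "\<theta> a = reg_lsq {1..n} c (\<lambda>i. X i a) (\<lambda>i. Y i a)" for a
  define u where "u a = matrix_inv (reg_gram {0..n} c (\<lambda>i. X' i a)) *v x a" for a
  define h where "h a = leverage {0..n} c (\<lambda>i. X' i a) 0" for a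
  define s where "s a = smp_var lam n (\<lambda>i. X i a) (x a)" for a
  define m where "m a = smp_mean lam n (\<lambda>i. X i a) (\<lambda>i. Y i a) (x a)" for a
  have c: "0 < c" using pos by (simp add: c_def)
  have upd: "(\<lambda>i. X i a)(0 := x a) = (\<lambda>i. X' i a)" for a
    by (auto simp: X'_def)
  have X': "X' i \<in> borel_measurable M" if "i \<in> {0..n}" for i
    using X[of i] x that by (cases "i = 0") (auto simp: X'_def[abs_def])
  have [measurable]: "\<theta> \<in> borel_measurable M" "u \<in> borel_measurable M" "h \<in> borel_measurable M"
    unfolding \<theta>_def[abs_def] u_def[abs_def] h_def[abs_def]
    by (intro borel_measurable_reg_lsq borel_measurable_reg_gram_inverse borel_measurable_leverage
        c X Y X' x; simp)+
  have "inverse (s a) = (1 - h a)\<^sup>2 + lam * (norm (u a))\<^sup>2" for a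
    unfolding s_def inverse_smp_var[OF pos] upd c_def[symmetric] h_def u_def ..
  then have s: "s a = inverse ((1 - h a)\<^sup>2 + lam * (norm (u a))\<^sup>2)" for a
    by (metis inverse_inverse_eq)
  have [measurable]: "s \<in> borel_measurable M"
    unfolding s[abs_def] by measurable
  have m: "m a = \<theta> a \<bullet> x a - lam * s a * (\<theta> a \<bullet> u a)" for a
    unfolding m_def smp_mean_def Let_def inner_mat_def K_mat_eq[OF pos(2)] ridge_eq_reg_lsq[OF pos]
    by (simp add: upd s_def \<theta>_def u_def reg_gram_inverse_sym[OF c] flip: c_def)
  have [measurable]: "m \<in> borel_measurable M"
    unfolding m[abs_def] by measurable
  have "(\<lambda>a. normal_dens (m a) (s a) (y a)) \<in> borel_measurable M"
    unfolding normal_dens_def normal_density_def by measurable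
  then show ?thesis
    unfolding smp_eq_normal_dens[OF pos] m_def s_def .
qed

subsection \<open>Exchangeability and independence\<close>

lemma reg_gram_cong: "(\<And>i. i \<in> I \<Longrightarrow> X i = X' i) \<Longrightarrow> reg_gram I c X = reg_gram I c X'"
  by (simp add: reg_gram_def)

lemma leverage_cong:
  "(\<And>i. i \<in> I \<Longrightarrow> X i = X' i) \<Longrightarrow> k \<in> I \<Longrightarrow> leverage I c X k = leverage I c X' k"
  using reg_gram_cong[of I X X' c] by (simp add: leverage_def)

lemma reg_lsq_cong:
  "(\<And>i. i \<in> I \<Longrightarrow> X i = X' i) \<Longrightarrow> (\<And>i. i \<in> I \<Longrightarrow> Y i = Y' i) \<Longrightarrow>
    reg_lsq I c X Y = reg_lsq I c X' Y'"
  using reg_gram_cong[of I X X' c] by (simp add: reg_lsq_def)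

lemma reg_gram_permute:
  "\<pi> permutes I \<Longrightarrow> reg_gram I c (\<lambda>i. X (\<pi> i)) = reg_gram I c X"
  using sum.permute[of \<pi> I "\<lambda>i. outer (X i)"] by (simp add: reg_gram_def comp_def)

lemma leverage_permute:
  "\<pi> permutes I \<Longrightarrow> leverage I c (\<lambda>i. X (\<pi> i)) k = leverage I c X (\<pi> k)"
  by (simp add: leverage_def reg_gram_permute)

lemma reg_lsq_permute:
  "\<pi> permutes I \<Longrightarrow> reg_lsq I c (\<lambda>i. X (\<pi> i)) (\<lambda>i. Y (\<pi> i)) = reg_lsq I c X Y"
  using sum.permute[of \<pi> I "\<lambda>i. Y i *\<^sub>R X i"] by (simp add: reg_lsq_def reg_gram_permute comp_def)

text \<open>Allows the sample to be replaced by its restriction to \<open>{1..n}\<close>, the form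
  in which it is a random element of a product space.\<close>

lemma smp_cong:
  assumes "\<And>i. i \<in> {1..n} \<Longrightarrow> X i = X' i" "\<And>i. i \<in> {1..n} \<Longrightarrow> Y i = Y' i"
  shows "smp lam n X Y x y = smp lam n X' Y' x y"
proof -
  have "pen_objective lam n X Y = pen_objective lam n X' Y'"
    by (simp add: pen_objective_def fun_eq_iff assms)
  then show ?thesis by (simp add: smp_def smp_weight_def pen_estimator_def)
qed

text \<open>Turns the second moment of X into integrability of the matrix-valued map
  \<open>outer\<close>.\<close>

lemma norm_outer: "norm (outer x) = (norm x)\<^sup>2"
proof -
  have "outer x $ i = (x $ i) *\<^sub>R x" for i by (simp add: outer_def vec_eq_iff)
  then have "norm (outer x) = L2_set (\<lambda>i. norm (x $ i) * norm x) UNIV"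
    by (simp add: norm_vec_def[of "outer x"])
  also have "\<dots> = (norm x)\<^sup>2"
    by (simp add: norm_vec_def[of x] L2_set_left_distrib[symmetric] L2_set_nonneg power2_eq_square)
  finally show ?thesis .
qed

lemma trace_eq_sum_axis:
  fixes A :: "real ^ 'd ^ 'd"
  shows "trace A = (\<Sum>j\<in>UNIV. axis j 1 \<bullet> (A *v axis j 1))"
  by (simp add: trace_def inner_axis' matrix_vector_mul_component inner_axis)

text \<open>The joint law is the product measure with all factors equal to D, and reindexing
  coordinates by a permutation preserves it.\<close>

lemma (in prob_space) iid_permute_integral:
  fixes f :: "('i \<Rightarrow> 'b) \<Rightarrow> real"
  assumes indep: "indep_vars (\<lambda>_. N) Z I" and "I \<noteq> {}"
    and D: "\<And>i. i \<in> I \<Longrightarrow> distr M N (Z i) = D"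
    and \<pi>: "\<pi> permutes I" and f: "f \<in> borel_measurable (PiM I (\<lambda>_. N))"
  shows "(\<integral>\<omega>. f (\<lambda>i\<in>I. Z (\<pi> i) \<omega>) \<partial>M) = (\<integral>\<omega>. f (\<lambda>i\<in>I. Z i \<omega>) \<partial>M)"
proof -
  let ?Z = "\<lambda>\<omega>. \<lambda>i\<in>I. Z i \<omega>" and ?t = "\<lambda>z. \<lambda>i\<in>I. z (\<pi> i)"
  have rv: "Z i \<in> measurable M N" if "i \<in> I" for i
    using indep that by (simp add: indep_vars_def2)
  then have mZ: "?Z \<in> measurable M (PiM I (\<lambda>_. N))" by (intro measurable_restrict)
  have \<pi>I: "\<pi> i \<in> I \<longleftrightarrow> i \<in> I" for i using \<pi> by (rule permutes_in_image)
  have mt: "?t \<in> measurable (PiM I (\<lambda>_. N)) (PiM I (\<lambda>_. N))"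
    by (intro measurable_restrict measurable_component_singleton) (simp add: \<pi>I)
  have ft: "(\<lambda>z. f (?t z)) \<in> borel_measurable (PiM I (\<lambda>_. N))"
    by (rule measurable_compose[OF mt f])
  have joint: "distr M (PiM I (\<lambda>_. N)) ?Z = PiM I (\<lambda>_. D)"
    using indep_vars_iff_distr_eq_PiM'[where I = I and M' = "\<lambda>_. N" and X = Z] assms(2) rv indep D
    by (simp cong: PiM_cong)
  obtain i0 where i0: "i0 \<in> I" using assms(2) by blast
  have pD: "prob_space D" using D[OF i0] prob_space_distr[OF rv[OF i0]] by simp
  have sets_D: "sets D = sets N" using D[OF i0] by (metis sets_distr)
  have sets_P: "sets (PiM I (\<lambda>_. D)) = sets (PiM I (\<lambda>_. N))"
    by (intro sets_PiM_cong sets_D refl)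
  have "(\<integral>\<omega>. f (\<lambda>i\<in>I. Z (\<pi> i) \<omega>) \<partial>M) = (\<integral>\<omega>. f (?t (?Z \<omega>)) \<partial>M)"
    by (intro Bochner_Integration.integral_cong refl arg_cong[where f = f]) (auto simp: \<pi>I restrict_def)
  also have "\<dots> = (\<integral>z. f (?t z) \<partial>PiM I (\<lambda>_. D))"
    unfolding joint[symmetric] by (rule integral_distr[OF mZ ft, symmetric])
  also have "\<dots> = (\<integral>z. f z \<partial>distr (PiM I (\<lambda>_. D)) (PiM I (\<lambda>_. D)) ?t)"
    by (intro integral_distr[symmetric] mt[folded measurable_cong_sets[OF sets_P sets_P]]
        f[folded measurable_cong_sets[OF sets_P refl]])
  also have "distr (PiM I (\<lambda>_. D)) (PiM I (\<lambda>_. D)) ?t = PiM I (\<lambda>_. D)"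
    using permutes_inj_on[OF \<pi>, of I] \<pi>I by (intro distr_PiM_reindex pD) auto
  also have "(\<integral>z. f z \<partial>PiM I (\<lambda>_. D)) = (\<integral>\<omega>. f (?Z \<omega>) \<partial>M)"
    unfolding joint[symmetric] by (rule integral_distr[OF mZ f])
  finally show ?thesis .
qed

text \<open>Fubini on the product of the two marginal laws, which is the joint law by independence.
  It allows the test pair to be evaluated at a separate \<open>\<omega>'\<close> inside the risk and
  then merged with the \<open>\<omega>\<close> of the sample.\<close>

lemma (in prob_space) indep_var_iterated_integral:
  fixes F :: "'b \<times> 'b \<Rightarrow> real"
  assumes indep: "indep_var S V T W" and F: "F \<in> borel_measurable (S \<Otimes>\<^sub>M T)"
    and int: "integrable M (\<lambda>\<omega>. F (V \<omega>, W \<omega>))"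
  shows "integrable M (\<lambda>\<omega>. \<integral>\<omega>'. F (V \<omega>, W \<omega>') \<partial>M)"
    and "(\<integral>\<omega>. (\<integral>\<omega>'. F (V \<omega>, W \<omega>') \<partial>M) \<partial>M) = (\<integral>\<omega>. F (V \<omega>, W \<omega>) \<partial>M)"
proof -
  have V: "V \<in> measurable M S" and W: "W \<in> measurable M T"
    and joint: "distr M S V \<Otimes>\<^sub>M distr M T W = distr M (S \<Otimes>\<^sub>M T) (\<lambda>\<omega>. (V \<omega>, W \<omega>))"
    using indep unfolding indep_var_distribution_eq by blast+
  interpret DV: prob_space "distr M S V" by (rule prob_space_distr[OF V])
  interpret DW: prob_space "distr M T W" by (rule prob_space_distr[OF W])
  interpret pair_prob_space "distr M S V" "distr M T W" ..
  have VW: "(\<lambda>\<omega>. (V \<omega>, W \<omega>)) \<in> measurable M (S \<Otimes>\<^sub>M T)" using V W by measurable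
  have intP: "integrable (distr M S V \<Otimes>\<^sub>M distr M T W) F"
    unfolding joint using int by (simp add: integrable_distr_eq[OF VW F])
  have inner: "(\<integral>w. F (v, w) \<partial>distr M T W) = (\<integral>\<omega>'. F (v, W \<omega>') \<partial>M)" if "v \<in> space S" for v
    by (rule integral_distr[OF W]) (rule measurable_compose[OF measurable_Pair1'[OF that] F])
  have int1: "integrable (distr M S V) (\<lambda>v. \<integral>w. F (v, w) \<partial>distr M T W)"
    by (rule integrable_fst'[OF intP])
  then have int2: "integrable (distr M S V) (\<lambda>v. \<integral>\<omega>'. F (v, W \<omega>') \<partial>M)"
    by (rule iffD1[OF Bochner_Integration.integrable_cong, rotated -1]) (simp_all add: inner)
  then show "integrable M (\<lambda>\<omega>. \<integral>\<omega>'. F (V \<omega>, W \<omega>') \<partial>M)"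
    by (rule integrable_distr[OF V])
  have "(\<integral>\<omega>. (\<integral>\<omega>'. F (V \<omega>, W \<omega>') \<partial>M) \<partial>M) = (\<integral>v. (\<integral>\<omega>'. F (v, W \<omega>') \<partial>M) \<partial>distr M S V)"
    using borel_measurable_integrable[OF int2] by (intro integral_distr[OF V, symmetric]) simp
  also have "\<dots> = (\<integral>v. (\<integral>w. F (v, w) \<partial>distr M T W) \<partial>distr M S V)"
    by (intro Bochner_Integration.integral_cong) (simp_all add: inner)
  also have "\<dots> = (\<integral>p. F p \<partial>(distr M S V \<Otimes>\<^sub>M distr M T W))"
    by (rule integral_fst'[OF intP])
  also have "\<dots> = (\<integral>\<omega>. F (V \<omega>, W \<omega>) \<partial>M)"
    unfolding joint by (rule integral_distr[OF VW F])
  finally show "(\<integral>\<omega>. (\<integral>\<omega>'. F (V \<omega>, W \<omega>') \<partial>M) \<partial>M) = (\<integral>\<omega>. F (V \<omega>, W \<omega>) \<partial>M)" .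
qed

subsection \<open>Expected leverage\<close>

lemma borel_measurable_pair_components:
  fixes I :: "'i set"
  assumes "i \<in> I"
  defines "P \<equiv> PiM I (\<lambda>_. borel :: ('b::topological_space \<times> 'c::topological_space) measure)"
  shows "(\<lambda>z. fst (z i)) \<in> borel_measurable P" "(\<lambda>z. snd (z i)) \<in> borel_measurable P"
proof -
  have z: "(\<lambda>z. z i) \<in> measurable P borel"
    unfolding P_def by (rule measurable_component_singleton[OF assms(1)])
  have "fst \<in> borel_measurable (borel :: ('b \<times> 'c) measure)"
    "snd \<in> borel_measurable (borel :: ('b \<times> 'c) measure)"
    by (intro borel_measurable_continuous_onI continuous_on_fst continuous_on_snd continuous_on_id)+
  then show "(\<lambda>z. fst (z i)) \<in> borel_measurable P" "(\<lambda>z. snd (z i)) \<in> borel_measurable P"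
    by (simp_all add: measurable_compose[OF z])
qed

locale iid_sample = prob_space M
  for M :: "'w measure" +
  fixes n :: nat and X :: "nat \<Rightarrow> 'w \<Rightarrow> real ^ 'd" and Y :: "nat \<Rightarrow> 'w \<Rightarrow> real"
  assumes indep: "indep_vars (\<lambda>_. borel) (\<lambda>i \<omega>. (X i \<omega>, Y i \<omega>)) {0..n}"
    and ident: "\<And>i. i \<in> {1..n} \<Longrightarrow>
      distr M borel (\<lambda>\<omega>. (X i \<omega>, Y i \<omega>)) = distr M borel (\<lambda>\<omega>. (X 0 \<omega>, Y 0 \<omega>))"
    and integrable_norm_sq: "integrable M (\<lambda>\<omega>. (norm (X 0 \<omega>))\<^sup>2)"
    and integrable_response_sq: "integrable M (\<lambda>\<omega>. (Y 0 \<omega>)\<^sup>2)"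
begin

section \<open>Transfer of measurability and moments from the test pair to the sample\<close>

lemma measurable_pair: "i \<le> n \<Longrightarrow> (\<lambda>\<omega>. (X i \<omega>, Y i \<omega>)) \<in> measurable M borel"
  using indep by (simp add: indep_vars_def2)

lemma measurable_X: "i \<le> n \<Longrightarrow> X i \<in> borel_measurable M"
  using measurable_compose[OF measurable_pair, of i fst borel]
  by (simp add: borel_measurable_continuous_onI continuous_on_fst)

lemma measurable_Y: "i \<le> n \<Longrightarrow> Y i \<in> borel_measurable M"
  using measurable_compose[OF measurable_pair, of i snd borel]
  by (simp add: borel_measurable_continuous_onI continuous_on_snd)

lemma distr_pair:
  "i \<le> n \<Longrightarrow> distr M borel (\<lambda>\<omega>. (X i \<omega>, Y i \<omega>)) = distr M borel (\<lambda>\<omega>. (X 0 \<omega>, Y 0 \<omega>))"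
  using ident[of i] by (cases "i = 0") simp_all

lemma
  fixes f :: "(real ^ 'd) \<times> real \<Rightarrow> real"
  assumes "i \<le> n" and f: "f \<in> borel_measurable borel"
  shows integral_pair: "(\<integral>\<omega>. f (X i \<omega>, Y i \<omega>) \<partial>M) = (\<integral>\<omega>. f (X 0 \<omega>, Y 0 \<omega>) \<partial>M)"
    and integrable_pair:
      "integrable M (\<lambda>\<omega>. f (X i \<omega>, Y i \<omega>)) \<longleftrightarrow> integrable M (\<lambda>\<omega>. f (X 0 \<omega>, Y 0 \<omega>))"
proof -
  show "(\<integral>\<omega>. f (X i \<omega>, Y i \<omega>) \<partial>M) = (\<integral>\<omega>. f (X 0 \<omega>, Y 0 \<omega>) \<partial>M)"
    using integral_distr[OF measurable_pair[OF assms(1)] f] integral_distr[OF measurable_pair[of 0] f]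
    by (simp add: distr_pair[OF assms(1)])
  show "integrable M (\<lambda>\<omega>. f (X i \<omega>, Y i \<omega>)) \<longleftrightarrow> integrable M (\<lambda>\<omega>. f (X 0 \<omega>, Y 0 \<omega>))"
    using integrable_distr_eq[OF measurable_pair[OF assms(1)] f]
      integrable_distr_eq[OF measurable_pair[of 0] f]
    by (simp add: distr_pair[OF assms(1)])
qed

lemma integrable_Y_sq: "i \<le> n \<Longrightarrow> integrable M (\<lambda>\<omega>. (Y i \<omega>)\<^sup>2)"
  using integrable_pair[of i "\<lambda>p. (snd p)\<^sup>2"] integrable_response_sq
  by (simp add: borel_measurable_continuous_onI continuous_intros)

lemma integrable_inner_sq: "integrable M (\<lambda>\<omega>. (X 0 \<omega> \<bullet> v)\<^sup>2)"
proof (rule Bochner_Integration.integrable_bound)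
  show "integrable M (\<lambda>\<omega>. (norm v)\<^sup>2 * (norm (X 0 \<omega>))\<^sup>2)"
    using integrable_norm_sq by simp
  show "(\<lambda>\<omega>. (X 0 \<omega> \<bullet> v)\<^sup>2) \<in> borel_measurable M"
    using measurable_X[of 0] by measurable
  have "(X 0 \<omega> \<bullet> v)\<^sup>2 \<le> (norm v)\<^sup>2 * (norm (X 0 \<omega>))\<^sup>2" for \<omega>
    using Cauchy_Schwarz_ineq[of "X 0 \<omega>" v] by (simp add: power2_norm_eq_inner mult.commute)
  then show "AE \<omega> in M. norm ((X 0 \<omega> \<bullet> v)\<^sup>2) \<le> norm ((norm v)\<^sup>2 * (norm (X 0 \<omega>))\<^sup>2)"
    by simp
qed

lemma integrable_sq_loss: "integrable M (\<lambda>\<omega>. (Y 0 \<omega> - \<theta> \<bullet> X 0 \<omega>)\<^sup>2 / 2)"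
proof (rule Bochner_Integration.integrable_bound)
  show "integrable M (\<lambda>\<omega>. (Y 0 \<omega>)\<^sup>2 + (X 0 \<omega> \<bullet> \<theta>)\<^sup>2)"
    using integrable_response_sq integrable_inner_sq by simp
  show "(\<lambda>\<omega>. (Y 0 \<omega> - \<theta> \<bullet> X 0 \<omega>)\<^sup>2 / 2) \<in> borel_measurable M"
    using measurable_X[of 0] measurable_Y[of 0] by measurable
  have "(y - t)\<^sup>2 / 2 \<le> y\<^sup>2 + t\<^sup>2" for y t :: real
    using zero_le_power2[of "y + t"] by (simp add: power2_eq_square algebra_simps)
  then show "AE \<omega> in M. norm ((Y 0 \<omega> - \<theta> \<bullet> X 0 \<omega>)\<^sup>2 / 2) \<le> norm ((Y 0 \<omega>)\<^sup>2 + (X 0 \<omega> \<bullet> \<theta>)\<^sup>2)"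
    by (simp add: inner_commute)
qed

lemma risk_gauss_model: "risk M (X 0) (Y 0) (gauss_model \<theta>) = (\<integral>\<omega>. (Y 0 \<omega> - \<theta> \<bullet> X 0 \<omega>)\<^sup>2 / 2 \<partial>M)"
  unfolding risk_def neg_ln_gauss_model ..

text \<open>The quadratic form at a fixed v is a bounded linear functional of the matrix, so it
  commutes with the Bochner integral defining \<open>cov_mat\<close>.\<close>

lemma cov_mat_quadratic: "(cov_mat M (X 0) *v v) \<bullet> v = (\<integral>\<omega>. (X 0 \<omega> \<bullet> v)\<^sup>2 \<partial>M)"
proof -
  have "(\<lambda>\<omega>. outer (X 0 \<omega>)) \<in> borel_measurable M"
    unfolding outer_def
    using borel_measurable_vec_nth[OF measurable_X[of 0]]
    by (intro borel_measurable_vecI) simp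
  then have int: "integrable M (\<lambda>\<omega>. outer (X 0 \<omega>))"
    by (rule Bochner_Integration.integrable_bound[OF integrable_norm_sq]) (simp add: norm_outer)
  have "linear (\<lambda>A :: real ^ 'd ^ 'd. (A *v v) \<bullet> v)"
    by (rule linearI)
       (simp_all add: matrix_vector_mult_add_rdistrib inner_add_left flip: scaleR_matrix_vector_assoc)
  then have "bounded_linear (\<lambda>A :: real ^ 'd ^ 'd. (A *v v) \<bullet> v)"
    by (simp add: linear_conv_bounded_linear)
  from integral_bounded_linear[OF this int] show ?thesis
    by (simp add: cov_mat_def outer_mult_vec power2_eq_square)
qed

text \<open>Exchangeability: the transposition of \<open>0\<close> and \<open>i\<close> carries \<open>f 0\<close> to \<open>f i\<close>.\<close>

lemma exchange:
  fixes f :: "nat \<Rightarrow> (nat \<Rightarrow> real ^ 'd) \<Rightarrow> (nat \<Rightarrow> real) \<Rightarrow> real"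
  assumes "i \<le> n"
    and f: "(\<lambda>z. f 0 (\<lambda>j. fst (z j)) (\<lambda>j. snd (z j))) \<in> borel_measurable (PiM {0..n} (\<lambda>_. borel))"
    and cong: "\<And>x y x' y'. (\<And>j. j \<le> n \<Longrightarrow> x j = x' j) \<Longrightarrow> (\<And>j. j \<le> n \<Longrightarrow> y j = y' j) \<Longrightarrow>
      f 0 x y = f 0 x' y'"
    and sym: "\<And>x y \<pi>. \<pi> permutes {0..n} \<Longrightarrow>
      f 0 (\<lambda>j. x (\<pi> j)) (\<lambda>j. y (\<pi> j)) = f (\<pi> 0) x y"
  shows "(\<integral>\<omega>. f i (\<lambda>j. X j \<omega>) (\<lambda>j. Y j \<omega>) \<partial>M) = (\<integral>\<omega>. f 0 (\<lambda>j. X j \<omega>) (\<lambda>j. Y j \<omega>) \<partial>M)"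
proof -
  define \<pi> where "\<pi> = Transposition.transpose 0 i"
  have \<pi>: "\<pi> permutes {0..n}" unfolding \<pi>_def using assms(1) by (intro permutes_swap_id) auto
  have \<pi>0: "\<pi> 0 = i" by (simp add: \<pi>_def)
  define g where "g z = f 0 (\<lambda>j. fst (z j)) (\<lambda>j. snd (z j))" for z
  have restr: "g (restrict z {0..n}) = g z" for z
    unfolding g_def by (rule cong) simp_all
  have "(\<integral>\<omega>. g (\<lambda>j\<in>{0..n}. (X (\<pi> j) \<omega>, Y (\<pi> j) \<omega>)) \<partial>M) =
      (\<integral>\<omega>. g (\<lambda>j\<in>{0..n}. (X j \<omega>, Y j \<omega>)) \<partial>M)"
    by (rule iid_permute_integral[OF indep _ distr_pair \<pi>]) (use f in \<open>auto simp: g_def[abs_def]\<close>)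
  then have "(\<integral>\<omega>. f 0 (\<lambda>j. X (\<pi> j) \<omega>) (\<lambda>j. Y (\<pi> j) \<omega>) \<partial>M) =
      (\<integral>\<omega>. f 0 (\<lambda>j. X j \<omega>) (\<lambda>j. Y j \<omega>) \<partial>M)"
    unfolding restr by (simp add: g_def)
  then show ?thesis using sym[OF \<pi>, of "\<lambda>j. X j _" "\<lambda>j. Y j _"] by (simp add: \<pi>0)
qed

text \<open>By exchangeability the left side is the expected sum of all leverages, d - c E tr(B^-1).
  Replacing B^-1 by its tangent at E B = (n + 1) A, where A = \<Sigma> + lam I, bounds this by d -
  lam tr(A^-1), which is the degrees of freedom.\<close>

lemma expected_leverage_le:
  assumes "lam > 0"
  defines "c \<equiv> lam * (real n + 1)"
  shows "integrable M (\<lambda>\<omega>. leverage {0..n} c (\<lambda>i. X i \<omega>) 0)"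
    and "(real n + 1) * (\<integral>\<omega>. leverage {0..n} c (\<lambda>i. X i \<omega>) 0 \<partial>M) \<le> deg_freedom lam (cov_mat M (X 0))"
proof -
  have c: "0 < c" using assms by (simp add: c_def)
  have int: "integrable M (\<lambda>\<omega>. leverage {0..n} c (\<lambda>i. X i \<omega>) k)" if "k \<le> n" for k
    using that c
    by (intro integrable_const_bound[where B = 1])
       (auto intro!: AE_I2 borel_measurable_leverage measurable_X simp: leverage_bounds)
  then show "integrable M (\<lambda>\<omega>. leverage {0..n} c (\<lambda>i. X i \<omega>) 0)" by simp
  define A where "A = cov_mat M (X 0) + lam *\<^sub>R mat 1"
  define V where "V = matrix_inv A"
  \<comment> \<open>The factor 1 / (n + 1) appears because the expected Gram matrix is (n + 1) times
    \<open>A\<close>.\<close>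
  define w :: "'d \<Rightarrow> real ^ 'd" where "w j = (1 / (real n + 1)) *\<^sub>R (V *v axis j 1)" for j
  define K where "K \<omega> = matrix_inv (reg_gram {0..n} c (\<lambda>i. X i \<omega>))" for \<omega>
  have Av: "(A *v v) \<bullet> v = (\<integral>\<omega>. (X 0 \<omega> \<bullet> v)\<^sup>2 \<partial>M) + lam * (v \<bullet> v)" for v
    by (simp add: A_def matrix_vector_mult_add_rdistrib inner_add_left cov_mat_quadratic
        flip: scaleR_matrix_vector_assoc)
  have "invertible A"
  proof (rule invertible_pos_def)
    fix v :: "real ^ 'd" assume "v \<noteq> 0"
    then have "0 < lam * (v \<bullet> v)" using assms by simp
    then show "0 < (A *v v) \<bullet> v" unfolding Av by (intro add_nonneg_pos) simp_all
  qed
  then have AV: "A *v (V *v v) = v" "V *v (A *v v) = v" for v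
    by (simp_all add: V_def matrix_inv_vector_cancel)
  have Bw: "(reg_gram {0..n} c (\<lambda>i. X i \<omega>) *v v) \<bullet> v = (\<Sum>i\<in>{0..n}. (X i \<omega> \<bullet> v)\<^sup>2) + c * (v \<bullet> v)"
    for \<omega> v by (simp add: inner_reg_gram power2_eq_square)
  have intX: "integrable M (\<lambda>\<omega>. (X i \<omega> \<bullet> v)\<^sup>2)"
    and eqX: "(\<integral>\<omega>. (X i \<omega> \<bullet> v)\<^sup>2 \<partial>M) = (\<integral>\<omega>. (X 0 \<omega> \<bullet> v)\<^sup>2 \<partial>M)" if "i \<in> {0..n}" for i v
    using integrable_pair[of i "\<lambda>p. (fst p \<bullet> v)\<^sup>2"] integral_pair[of i "\<lambda>p. (fst p \<bullet> v)\<^sup>2"] that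
      integrable_inner_sq
    by (simp_all add: borel_measurable_continuous_onI continuous_intros)
  have intB: "integrable M (\<lambda>\<omega>. (reg_gram {0..n} c (\<lambda>i. X i \<omega>) *v v) \<bullet> v)" for v
    unfolding Bw by (intro Bochner_Integration.integrable_add Bochner_Integration.integrable_sum intX) auto
  have EB: "(\<integral>\<omega>. (reg_gram {0..n} c (\<lambda>i. X i \<omega>) *v v) \<bullet> v \<partial>M) = (real n + 1) * ((A *v v) \<bullet> v)" for v
  proof -
    have "(\<integral>\<omega>. (\<Sum>i\<in>{0..n}. (X i \<omega> \<bullet> v)\<^sup>2) + c * (v \<bullet> v) \<partial>M) =
        (\<Sum>i\<in>{0..n}. \<integral>\<omega>. (X i \<omega> \<bullet> v)\<^sup>2 \<partial>M) + c * (v \<bullet> v)"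
      using intX by (subst Bochner_Integration.integral_add)
        (auto simp: prob_space intro!: Bochner_Integration.integral_sum Bochner_Integration.integrable_sum)
    also have "(\<Sum>i\<in>{0..n}. \<integral>\<omega>. (X i \<omega> \<bullet> v)\<^sup>2 \<partial>M) = (\<Sum>i\<in>{0..n}. \<integral>\<omega>. (X 0 \<omega> \<bullet> v)\<^sup>2 \<partial>M)"
      by (intro sum.cong refl eqX)
    finally show ?thesis unfolding Bw Av by (simp add: c_def algebra_simps)
  qed
  \<comment> \<open>The tangent bound for the convex map \<open>B \<mapsto> B\<^sup>-\<^sup>1\<close> at the expectation of the random matrix \<open>B\<close>,
    where its inverse maps \<open>axis j 1\<close> to \<open>w j\<close>.\<close>
  have tangent: "2 * (axis j 1 \<bullet> w j) - (reg_gram {0..n} c (\<lambda>i. X i \<omega>) *v w j) \<bullet> w j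
      \<le> axis j 1 \<bullet> (K \<omega> *v axis j 1)" for j \<omega>
  proof -
    let ?B = "reg_gram {0..n} c (\<lambda>i. X i \<omega>)"
    \<comment> \<open>The error in the tangent bound is exactly this square, the B-norm of the
      difference between B^-1 e_j and w_j.\<close>
    have "0 \<le> (?B *v (K \<omega> *v axis j 1 - w j)) \<bullet> (K \<omega> *v axis j 1 - w j)"
      using c by (intro reg_gram_nonneg) simp
    also have "\<dots> = axis j 1 \<bullet> (K \<omega> *v axis j 1) - axis j 1 \<bullet> w j
        - (?B *v w j) \<bullet> (K \<omega> *v axis j 1) + (?B *v w j) \<bullet> w j"
      by (simp add: matrix_vector_mult_diff_distrib K_def reg_gram_inverse[OF c] inner_diff_left
          inner_diff_right)
    also have "(?B *v w j) \<bullet> (K \<omega> *v axis j 1) = axis j 1 \<bullet> w j"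
      unfolding reg_gram_sym by (simp add: K_def reg_gram_inverse[OF c] inner_commute)
    finally show ?thesis by simp
  qed
  \<comment> \<open>On average the quadratic term of the tangent equals half of its linear term, so
    the tangent bound has expectation e_j . w_j.\<close>
  have Ew: "(\<integral>\<omega>. (reg_gram {0..n} c (\<lambda>i. X i \<omega>) *v w j) \<bullet> w j \<partial>M) = axis j 1 \<bullet> w j" for j
    unfolding EB by (simp add: w_def[of j] matrix_vector_mult_scaleR AV)
  have sum_le: "(\<Sum>i\<in>{0..n}. leverage {0..n} c (\<lambda>i. X i \<omega>) i) \<le> real CARD('d) - c * (\<Sum>j\<in>UNIV.
      2 * (axis j 1 \<bullet> w j) - (reg_gram {0..n} c (\<lambda>i. X i \<omega>) *v w j) \<bullet> w j)" for \<omega>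
    unfolding sum_leverage[OF c]
    using c tangent by (intro diff_left_mono mult_left_mono sum_mono) (auto simp: K_def)
  have exch: "(\<integral>\<omega>. leverage {0..n} c (\<lambda>i. X i \<omega>) i \<partial>M) = (\<integral>\<omega>. leverage {0..n} c (\<lambda>i. X i \<omega>) 0 \<partial>M)"
    if "i \<le> n" for i
  proof (rule exchange[OF that, where f = "\<lambda>i x y. leverage {0..n} c x i"])
    show "(\<lambda>z. leverage {0..n} c (\<lambda>j. fst (z j :: (real ^ 'd) \<times> real)) 0)
        \<in> borel_measurable (PiM {0..n} (\<lambda>_. borel))"
      by (intro borel_measurable_leverage c borel_measurable_pair_components) auto
  qed (rule leverage_cong leverage_permute; simp)+
  have "(real n + 1) * (\<integral>\<omega>. leverage {0..n} c (\<lambda>i. X i \<omega>) 0 \<partial>M) =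
      (\<Sum>i\<in>{0..n}. \<integral>\<omega>. leverage {0..n} c (\<lambda>i. X i \<omega>) 0 \<partial>M)"
    by simp
  also have "\<dots> = (\<Sum>i\<in>{0..n}. \<integral>\<omega>. leverage {0..n} c (\<lambda>i. X i \<omega>) i \<partial>M)"
    by (intro sum.cong refl exch[symmetric]) simp
  also have "\<dots> = (\<integral>\<omega>. (\<Sum>i\<in>{0..n}. leverage {0..n} c (\<lambda>i. X i \<omega>) i) \<partial>M)"
    using int by (intro Bochner_Integration.integral_sum[symmetric]) simp
  also have "\<dots> \<le> (\<integral>\<omega>. real CARD('d) - c * (\<Sum>j\<in>UNIV.
      2 * (axis j 1 \<bullet> w j) - (reg_gram {0..n} c (\<lambda>i. X i \<omega>) *v w j) \<bullet> w j) \<partial>M)"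
    using int intB sum_le by (intro integral_mono) auto
  also have "\<dots> = real CARD('d) - c * (\<Sum>j\<in>UNIV. 2 * (axis j 1 \<bullet> w j) - axis j 1 \<bullet> w j)"
    using intB by (simp add: Bochner_Integration.integral_sum Ew prob_space)
  also have "\<dots> = real CARD('d) - lam * (\<Sum>j\<in>UNIV. axis j 1 \<bullet> (V *v axis j 1))"
    by (simp add: w_def c_def sum_distrib_left)
  also have "\<dots> = (\<Sum>j\<in>UNIV. axis j 1 \<bullet> (axis j 1 - lam *\<^sub>R (V *v axis j 1)))"
    by (simp add: inner_diff_right sum_subtractf sum_distrib_left inner_axis_axis)
  \<comment> \<open>With V = A^-1 and \<Sigma> = A - lam I, the product V \<Sigma> is I - lam
    V.\<close>
  also have "\<dots> = deg_freedom lam (cov_mat M (X 0))"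
  proof -
    have "cov_mat M (X 0) *v v = A *v v - lam *\<^sub>R v" for v
      by (simp add: A_def matrix_vector_mult_add_rdistrib flip: scaleR_matrix_vector_assoc)
    then have "V *v (cov_mat M (X 0) *v v) = v - lam *\<^sub>R (V *v v)" for v
      by (simp add: matrix_vector_mult_diff_distrib matrix_vector_mult_scaleR AV)
    then show ?thesis
      unfolding deg_freedom_def trace_eq_sum_axis A_def[symmetric] V_def[symmetric]
      by (simp flip: matrix_vector_mul_assoc)
  qed
  finally show "(real n + 1) * (\<integral>\<omega>. leverage {0..n} c (\<lambda>i. X i \<omega>) 0 \<partial>M)
      \<le> deg_freedom lam (cov_mat M (X 0))" .
qed

end

subsection \<open>Excess risk\<close>

text \<open>Contribution of point i to the minimal regularized objective of all n + 1 points, with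
  the penalty split equally among them. Every term uses the same estimator, which makes the family
  exchangeable.\<close>

definition pen_loss ::
  "real \<Rightarrow> nat \<Rightarrow> (nat \<Rightarrow> real ^ 'd) \<Rightarrow> (nat \<Rightarrow> real) \<Rightarrow> nat \<Rightarrow> real" where
  "pen_loss lam n X Y i =
     (Y i - reg_lsq {0..n} (lam * (real n + 1)) X Y \<bullet> X i)\<^sup>2 / 2
     + lam / 2 * (norm (reg_lsq {0..n} (lam * (real n + 1)) X Y))\<^sup>2"

lemma smp_energy_eq_pen_loss:
  "lam > 0 \<Longrightarrow> smp_energy lam n X Y x y / 2 = pen_loss lam n (X(0 := x)) (Y(0 := y)) 0"
  by (simp add: smp_energy_def pen_loss_def pen_estimator_eq_reg_lsq add_divide_distrib)

lemma pen_loss_nonneg: "lam > 0 \<Longrightarrow> 0 \<le> pen_loss lam n X Y i"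
  by (simp add: pen_loss_def)

lemma sum_pen_loss:
  "(\<Sum>i\<in>{0..n}. pen_loss lam n X Y i) =
    reg_obj {0..n} (lam * (real n + 1)) X Y (reg_lsq {0..n} (lam * (real n + 1)) X Y)"
  by (simp add: pen_loss_def reg_obj_def sum.distrib algebra_simps)

lemma sum_pen_loss_le:
  "lam > 0 \<Longrightarrow> (\<Sum>i\<in>{0..n}. pen_loss lam n X Y i) \<le> reg_obj {0..n} (lam * (real n + 1)) X Y \<theta>"
  unfolding sum_pen_loss by (rule reg_obj_minimal) simp

text \<open>A single nonnegative contribution is at most their sum, and that minimum is at most the
  objective at \<theta> = 0. The bound involves the responses only and serves as the integrable
  majorant.\<close>

lemma pen_loss_le:
  assumes "lam > 0" "i \<le> n" shows "pen_loss lam n X Y i \<le> (\<Sum>j\<in>{0..n}. (Y j)\<^sup>2 / 2)"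
proof -
  have "pen_loss lam n X Y i \<le> (\<Sum>i\<in>{0..n}. pen_loss lam n X Y i)"
    using assms by (intro member_le_sum) (auto simp: pen_loss_nonneg)
  also have "\<dots> \<le> (\<Sum>j\<in>{0..n}. (Y j)\<^sup>2 / 2)"
    using sum_pen_loss_le[OF assms(1), of n X Y 0] by (simp add: reg_obj_def)
  finally show ?thesis .
qed

lemma borel_measurable_pen_loss:
  assumes "lam > 0" "\<And>i. i \<le> n \<Longrightarrow> X i \<in> borel_measurable M" "\<And>i. i \<le> n \<Longrightarrow> Y i \<in> borel_measurable M"
    and "k \<le> n"
  shows "(\<lambda>a. pen_loss lam n (\<lambda>i. X i a) (\<lambda>i. Y i a) k) \<in> borel_measurable M"
proof -
  have [measurable]: "(\<lambda>a. reg_lsq {0..n} (lam * (real n + 1)) (\<lambda>i. X i a) (\<lambda>i. Y i a)) \<in> borel_measurable M"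
    using assms by (intro borel_measurable_reg_lsq) auto
  have [measurable]: "X k \<in> borel_measurable M" "Y k \<in> borel_measurable M" using assms by auto
  show ?thesis unfolding pen_loss_def by measurable
qed

context iid_sample
begin

section \<open>Expectation of the penalized loss and of the predictor's risk\<close>

lemma integrable_pen_loss:
  assumes "lam > 0" "k \<le> n"
  shows "integrable M (\<lambda>\<omega>. pen_loss lam n (\<lambda>i. X i \<omega>) (\<lambda>i. Y i \<omega>) k)"
proof (rule Bochner_Integration.integrable_bound)
  show "integrable M (\<lambda>\<omega>. \<Sum>j\<in>{0..n}. (Y j \<omega>)\<^sup>2 / 2)"
    by (intro Bochner_Integration.integrable_sum integrable_divide integrable_Y_sq) auto
  show "(\<lambda>\<omega>. pen_loss lam n (\<lambda>i. X i \<omega>) (\<lambda>i. Y i \<omega>) k) \<in> borel_measurable M"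
    using assms by (intro borel_measurable_pen_loss measurable_X measurable_Y)
  show "AE \<omega> in M. norm (pen_loss lam n (\<lambda>i. X i \<omega>) (\<lambda>i. Y i \<omega>) k)
      \<le> norm (\<Sum>j\<in>{0..n}. (Y j \<omega>)\<^sup>2 / 2)"
    by (intro AE_I2)
      (simp add: pen_loss_nonneg[OF assms(1)] pen_loss_le[OF assms] abs_of_nonneg sum_nonneg)
qed

text \<open>By exchangeability, n + 1 times the left side is the expected minimum of the objective.
  Comparing with a fixed \<theta> gives n + 1 times its regularized risk.\<close>

lemma expected_pen_loss_le:
  assumes "lam > 0"
  shows "(\<integral>\<omega>. pen_loss lam n (\<lambda>i. X i \<omega>) (\<lambda>i. Y i \<omega>) 0 \<partial>M)
    \<le> risk M (X 0) (Y 0) (gauss_model \<theta>) + lam / 2 * (norm \<theta>)\<^sup>2"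
proof -
  have exch: "(\<integral>\<omega>. pen_loss lam n (\<lambda>i. X i \<omega>) (\<lambda>i. Y i \<omega>) i \<partial>M) =
      (\<integral>\<omega>. pen_loss lam n (\<lambda>i. X i \<omega>) (\<lambda>i. Y i \<omega>) 0 \<partial>M)" if "i \<le> n" for i
  proof (rule exchange[OF that, where f = "\<lambda>i x y. pen_loss lam n x y i"])
    show "(\<lambda>z. pen_loss lam n (\<lambda>j. fst (z j :: (real ^ 'd) \<times> real)) (\<lambda>j. snd (z j)) 0)
        \<in> borel_measurable (PiM {0..n} (\<lambda>_. borel))"
      by (intro borel_measurable_pen_loss assms borel_measurable_pair_components) auto
  next
    fix x x' :: "nat \<Rightarrow> real ^ 'd" and y y' :: "nat \<Rightarrow> real"
    assume eq: "\<And>j. j \<le> n \<Longrightarrow> x j = x' j" "\<And>j. j \<le> n \<Longrightarrow> y j = y' j"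
    then have "reg_lsq {0..n} (lam * (real n + 1)) x y = reg_lsq {0..n} (lam * (real n + 1)) x' y'"
      by (intro reg_lsq_cong) auto
    with eq show "pen_loss lam n x y 0 = pen_loss lam n x' y' 0" by (simp add: pen_loss_def)
  next
    fix x :: "nat \<Rightarrow> real ^ 'd" and y :: "nat \<Rightarrow> real" and \<pi>
    assume "\<pi> permutes {0..n}"
    then show "pen_loss lam n (\<lambda>j. x (\<pi> j)) (\<lambda>j. y (\<pi> j)) 0 = pen_loss lam n x y (\<pi> 0)"
      unfolding pen_loss_def by (simp only: reg_lsq_permute)
  qed
  have intg: "integrable M (\<lambda>\<omega>. (Y i \<omega> - \<theta> \<bullet> X i \<omega>)\<^sup>2 / 2)"
    and eqg: "(\<integral>\<omega>. (Y i \<omega> - \<theta> \<bullet> X i \<omega>)\<^sup>2 / 2 \<partial>M) = risk M (X 0) (Y 0) (gauss_model \<theta>)"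
    if "i \<in> {0..n}" for i
    using integrable_pair[of i "\<lambda>p. (snd p - \<theta> \<bullet> fst p)\<^sup>2 / 2"]
      integral_pair[of i "\<lambda>p. (snd p - \<theta> \<bullet> fst p)\<^sup>2 / 2"] that integrable_sq_loss[of \<theta>]
    by (simp_all add: borel_measurable_continuous_onI continuous_intros risk_gauss_model)
  have "(real n + 1) * (\<integral>\<omega>. pen_loss lam n (\<lambda>i. X i \<omega>) (\<lambda>i. Y i \<omega>) 0 \<partial>M) =
      (\<Sum>i\<in>{0..n}. \<integral>\<omega>. pen_loss lam n (\<lambda>i. X i \<omega>) (\<lambda>i. Y i \<omega>) 0 \<partial>M)"
    by simp
  also have "\<dots> = (\<Sum>i\<in>{0..n}. \<integral>\<omega>. pen_loss lam n (\<lambda>i. X i \<omega>) (\<lambda>i. Y i \<omega>) i \<partial>M)"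
    by (intro sum.cong refl exch[symmetric]) simp
  also have "\<dots> = (\<integral>\<omega>. (\<Sum>i\<in>{0..n}. pen_loss lam n (\<lambda>i. X i \<omega>) (\<lambda>i. Y i \<omega>) i) \<partial>M)"
    using assms by (intro Bochner_Integration.integral_sum[symmetric] integrable_pen_loss) auto
  also have "\<dots> \<le> (\<integral>\<omega>. (\<Sum>i\<in>{0..n}. (Y i \<omega> - \<theta> \<bullet> X i \<omega>)\<^sup>2 / 2)
      + lam * (real n + 1) / 2 * (norm \<theta>)\<^sup>2 \<partial>M)"
  proof (rule integral_mono)
    show "integrable M (\<lambda>\<omega>. \<Sum>i\<in>{0..n}. pen_loss lam n (\<lambda>i. X i \<omega>) (\<lambda>i. Y i \<omega>) i)"
      using assms by (intro Bochner_Integration.integrable_sum integrable_pen_loss) auto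
    show "integrable M (\<lambda>\<omega>. (\<Sum>i\<in>{0..n}. (Y i \<omega> - \<theta> \<bullet> X i \<omega>)\<^sup>2 / 2)
        + lam * (real n + 1) / 2 * (norm \<theta>)\<^sup>2)"
      by (intro Bochner_Integration.integrable_add Bochner_Integration.integrable_sum intg) auto
  qed (use sum_pen_loss_le[OF assms] in \<open>simp add: reg_obj_def\<close>)
  also have "\<dots> = (\<integral>\<omega>. (\<Sum>i\<in>{0..n}. (Y i \<omega> - \<theta> \<bullet> X i \<omega>)\<^sup>2 / 2) \<partial>M)
      + lam * (real n + 1) / 2 * (norm \<theta>)\<^sup>2"
    by (subst Bochner_Integration.integral_add)
      (auto intro!: Bochner_Integration.integrable_sum intg simp: prob_space)
  also have "(\<integral>\<omega>. (\<Sum>i\<in>{0..n}. (Y i \<omega> - \<theta> \<bullet> X i \<omega>)\<^sup>2 / 2) \<partial>M) =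
      (\<Sum>i\<in>{0..n}. \<integral>\<omega>. (Y i \<omega> - \<theta> \<bullet> X i \<omega>)\<^sup>2 / 2 \<partial>M)"
    by (intro Bochner_Integration.integral_sum intg)
  also have "\<dots> = (\<Sum>i\<in>{0..n}. risk M (X 0) (Y 0) (gauss_model \<theta>))"
    by (intro sum.cong refl eqg)
  also have "\<dots> + lam * (real n + 1) / 2 * (norm \<theta>)\<^sup>2 =
      (real n + 1) * (risk M (X 0) (Y 0) (gauss_model \<theta>) + lam / 2 * (norm \<theta>)\<^sup>2)"
    by (simp add: algebra_simps)
  finally show ?thesis by (simp add: mult_le_cancel_left_pos)
qed

text \<open>The loss at the test pair is dominated by \<open>pen_loss\<close> plus 1.25 times the
  leverage as soon as the test point lies in the ball of radius R. This bound gives integrability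
  for a fixed sample and, after merging sample and test pair by independence, the bound in
  expectation.\<close>

lemma smp_risk:
  assumes "lam > 0" "n \<ge> 1" and bounded: "AE \<omega> in M. norm (X 0 \<omega>) \<le> R"
    and lam_ge: "lam \<ge> 2 * R\<^sup>2 / (real n + 1)"
  shows integrable_neg_ln_smp:
      "integrable M (\<lambda>\<omega>'. - ln (smp lam n x y (X 0 \<omega>') (Y 0 \<omega>')))" (is "?int")
    and integrable_smp_risk:
      "integrable M (\<lambda>\<omega>. risk M (X 0) (Y 0) (smp lam n (\<lambda>i. X i \<omega>) (\<lambda>i. Y i \<omega>)))" (is "?int_risk")
    and expected_smp_risk_le:
      "(\<integral>\<omega>. risk M (X 0) (Y 0) (smp lam n (\<lambda>i. X i \<omega>) (\<lambda>i. Y i \<omega>)) \<partial>M)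
        \<le> risk M (X 0) (Y 0) (gauss_model \<theta>) + lam / 2 * (norm \<theta>)\<^sup>2
          + 1.25 * (deg_freedom lam (cov_mat M (X 0)) / (real n + 1))" (is "?le")
proof -
  define c where "c = lam * (real n + 1)"
  have "0 < c" using assms by (simp add: c_def)
  moreover have "2 * R\<^sup>2 \<le> c" using lam_ge by (simp add: c_def pos_divide_le_eq)
  ultimately have c: "0 < c" "2 * R\<^sup>2 \<le> c" by simp_all
  have loss_le: "- ln (smp lam n x y (x' :: real ^ 'd) y') \<le>
      pen_loss lam n (x(0 := x')) (y(0 := y')) 0 + 1.25 * leverage {0..n} c (x(0 := x')) 0"
    and lev_le: "leverage {0..n} c (x(0 := x')) 0 \<le> 1 / 3" if "norm x' \<le> R" for x x' y y'
  proof -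
    show "leverage {0..n} c (x(0 := x')) 0 \<le> 1 / 3"
      using that by (intro leverage_le_third[OF c(1) _ _ _ c(2)]) auto
    then show "- ln (smp lam n x y x' y') \<le>
        pen_loss lam n (x(0 := x')) (y(0 := y')) 0 + 1.25 * leverage {0..n} c (x(0 := x')) 0"
      unfolding smp_energy_eq_pen_loss[OF assms(1), symmetric] c_def by (rule neg_ln_smp_le[OF assms(1,2)])
  qed
  show ?int
  proof (rule Bochner_Integration.integrable_bound)
    \<comment> \<open>The majorant combines the bound of \<open>pen_loss\<close> by the squared
      responses with leverage at most 1/3.\<close>
    show "integrable M (\<lambda>\<omega>'. (\<Sum>j=1..n. (y j)\<^sup>2 / 2) + (Y 0 \<omega>')\<^sup>2 / 2 + 1.25 * (1 / 3))"
      using integrable_response_sq by simp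
    show "(\<lambda>\<omega>'. - ln (smp lam n x y (X 0 \<omega>') (Y 0 \<omega>'))) \<in> borel_measurable M"
      by (intro borel_measurable_uminus borel_measurable_ln borel_measurable_smp assms
          measurable_X measurable_Y) auto
    show "AE \<omega>' in M. norm (- ln (smp lam n x y (X 0 \<omega>') (Y 0 \<omega>')))
        \<le> norm ((\<Sum>j=1..n. (y j)\<^sup>2 / 2) + (Y 0 \<omega>')\<^sup>2 / 2 + 1.25 * (1 / 3))"
      using bounded
    proof eventually_elim
      case (elim \<omega>')
      have "- ln (smp lam n x y (X 0 \<omega>') (Y 0 \<omega>')) \<le>
          (\<Sum>j\<in>{0..n}. ((y(0 := Y 0 \<omega>')) j)\<^sup>2 / 2) + 1.25 * (1 / 3)"
        using loss_le[OF elim, of x y "Y 0 \<omega>'"] lev_le[OF elim, of x]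
          pen_loss_le[OF assms(1) le0, of n "x(0 := X 0 \<omega>')" "y(0 := Y 0 \<omega>')"]
        by simp
      also have "\<dots> = (\<Sum>j=1..n. (y j)\<^sup>2 / 2) + (Y 0 \<omega>')\<^sup>2 / 2 + 1.25 * (1 / 3)"
        by (simp add: sum_atLeast0_split)
      finally show ?case
        using neg_ln_smp_nonneg[OF assms(1,2), of x y "X 0 \<omega>'" "Y 0 \<omega>'"]
        by simp
    qed
  qed
  \<comment> \<open>Sample and test pair are taken at the same \<open>\<omega>\<close> here;
    independence later identifies the expectation of \<open>L\<close> with the expected
    risk.\<close>
  define L where "L \<omega> = - ln (smp lam n (\<lambda>i. X i \<omega>) (\<lambda>i. Y i \<omega>) (X 0 \<omega>) (Y 0 \<omega>))" for \<omega>
  define U where "U \<omega> = pen_loss lam n (\<lambda>i. X i \<omega>) (\<lambda>i. Y i \<omega>) 0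
    + 1.25 * leverage {0..n} c (\<lambda>i. X i \<omega>) 0" for \<omega>
  have intU: "integrable M U"
    unfolding U_def using assms(1) expected_leverage_le(1)[OF assms(1)]
    by (auto intro!: Bochner_Integration.integrable_add integrable_pen_loss simp: c_def)
  have LU: "AE \<omega> in M. L \<omega> \<le> U \<omega>"
    using bounded
  proof eventually_elim
    case (elim \<omega>)
    \<comment> \<open>Overwriting slot 0 by the value already stored there changes nothing, so the
      augmented sample is the full sequence.\<close>
    show ?case using loss_le[OF elim, of "\<lambda>i. X i \<omega>" "\<lambda>i. Y i \<omega>" "Y 0 \<omega>"]
      by (simp add: L_def U_def fun_upd_triv[of "\<lambda>i. X i \<omega>" 0] fun_upd_triv[of "\<lambda>i. Y i \<omega>" 0])
  qed
  have L_nonneg: "0 \<le> L \<omega>" for \<omega>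
    unfolding L_def by (rule neg_ln_smp_nonneg[OF assms(1,2)])
  have intL: "integrable M L"
  proof (rule Bochner_Integration.integrable_bound[OF intU])
    show "L \<in> borel_measurable M"
      unfolding L_def
      by (intro borel_measurable_uminus borel_measurable_ln borel_measurable_smp assms
          measurable_X measurable_Y) auto
    show "AE \<omega> in M. norm (L \<omega>) \<le> norm (U \<omega>)"
      using LU by eventually_elim (use L_nonneg in \<open>auto simp: abs_of_nonneg intro: order_trans\<close>)
  qed
  define Z where "Z i \<omega> = (X i \<omega>, Y i \<omega>)" for i \<omega>
  define F where "F p = - ln (smp lam n (\<lambda>i. fst (fst p i)) (\<lambda>i. snd (fst p i))
    (fst (snd p 0)) (snd (snd p 0)))" for p :: "(nat \<Rightarrow> (real ^ 'd) \<times> real) \<times> (nat \<Rightarrow> (real ^ 'd) \<times> real)"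
  \<comment> \<open>Both blocks are restricted sequences, the test pair being a sequence on
    \<open>{0}\<close>: independence of disjoint blocks is available in this form, and both have the
    same type.\<close>
  define V where "V \<omega> = restrict (\<lambda>i. Z i \<omega>) {1..n}" for \<omega>
  define W where "W \<omega> = restrict (\<lambda>i. Z i \<omega>) {0}" for \<omega>
  have ind: "indep_var (PiM {1..n} (\<lambda>_. borel)) V (PiM {0} (\<lambda>_. borel)) W"
    unfolding V_def W_def Z_def by (intro indep_var_restrict[OF indep]) auto
  have F: "F \<in> borel_measurable (PiM {1..n} (\<lambda>_. borel) \<Otimes>\<^sub>M PiM {0} (\<lambda>_. borel))"
    unfolding F_def
    by (intro borel_measurable_uminus borel_measurable_ln borel_measurable_smp assms
        measurable_compose[OF measurable_fst borel_measurable_pair_components(1)]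
        measurable_compose[OF measurable_fst borel_measurable_pair_components(2)]
        measurable_compose[OF measurable_snd borel_measurable_pair_components(1)]
        measurable_compose[OF measurable_snd borel_measurable_pair_components(2)]) auto
  have FVW: "F (V \<omega>, W \<omega>') = - ln (smp lam n (\<lambda>i. X i \<omega>) (\<lambda>i. Y i \<omega>) (X 0 \<omega>') (Y 0 \<omega>'))" for \<omega> \<omega>'
  proof -
    have "smp lam n (\<lambda>i. fst (V \<omega> i)) (\<lambda>i. snd (V \<omega> i)) = smp lam n (\<lambda>i. X i \<omega>) (\<lambda>i. Y i \<omega>)"
      by (intro ext smp_cong) (simp_all add: V_def Z_def)
    then show ?thesis by (simp add: F_def W_def Z_def)
  qed
  have FL: "F (V \<omega>, W \<omega>) = L \<omega>" for \<omega> unfolding FVW L_def ..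
  have risk_eq: "risk M (X 0) (Y 0) (smp lam n (\<lambda>i. X i \<omega>) (\<lambda>i. Y i \<omega>)) = (\<integral>\<omega>'. F (V \<omega>, W \<omega>') \<partial>M)" for \<omega>
    unfolding risk_def FVW ..
  have intF: "integrable M (\<lambda>\<omega>. F (V \<omega>, W \<omega>))" unfolding FL by (rule intL)
  show ?int_risk
    unfolding risk_eq by (rule indep_var_iterated_integral(1)[OF ind F intF])
  have "(\<integral>\<omega>. risk M (X 0) (Y 0) (smp lam n (\<lambda>i. X i \<omega>) (\<lambda>i. Y i \<omega>)) \<partial>M) = (\<integral>\<omega>. L \<omega> \<partial>M)"
    unfolding risk_eq using indep_var_iterated_integral(2)[OF ind F intF] by (simp add: FL)
  also have "\<dots> \<le> (\<integral>\<omega>. U \<omega> \<partial>M)" by (rule integral_mono_AE[OF intL intU LU])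
  also have "\<dots> = (\<integral>\<omega>. pen_loss lam n (\<lambda>i. X i \<omega>) (\<lambda>i. Y i \<omega>) 0 \<partial>M)
      + 1.25 * (\<integral>\<omega>. leverage {0..n} c (\<lambda>i. X i \<omega>) 0 \<partial>M)"
    unfolding U_def using integrable_pen_loss[OF assms(1)] expected_leverage_le(1)[OF assms(1)]
    by (simp add: c_def)
  also have "\<dots> \<le> (risk M (X 0) (Y 0) (gauss_model \<theta>) + lam / 2 * (norm \<theta>)\<^sup>2)
      + 1.25 * (deg_freedom lam (cov_mat M (X 0)) / (real n + 1))"
  proof (intro add_mono mult_left_mono expected_pen_loss_le assms)
    show "(\<integral>\<omega>. leverage {0..n} c (\<lambda>i. X i \<omega>) 0 \<partial>M) \<le> deg_freedom lam (cov_mat M (X 0)) / (real n + 1)"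
      using expected_leverage_le(2)[OF assms(1)]
      by (subst pos_le_divide_eq) (simp_all add: c_def mult.commute)
  qed simp
  finally show ?le .
qed

end

theorem theorem5:
  fixes lam :: real and n :: nat
  assumes "lam > 0" and "n \<ge> 1"
  shows
    "(\<forall>(X :: nat \<Rightarrow> real ^ 'd) (Y :: nat \<Rightarrow> real) x.
        smp_well_defined lam n X Y x \<and>
        smp_var lam n X x > 0 \<and>
        (\<forall>y. smp lam n X Y x y = normal_dens (smp_mean lam n X Y x) (smp_var lam n X x) y))
     \<and>
     (\<forall>(M :: 'w measure) (X :: nat \<Rightarrow> 'w \<Rightarrow> real ^ 'd) (Y :: nat \<Rightarrow> 'w \<Rightarrow> real) (R :: real).
        prob_space M \<longrightarrow>
        \<comment> \<open>index 0 is the generic pair, indices 1 to n are the sample\<close>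
        prob_space.indep_vars M (\<lambda>_. borel) (\<lambda>i \<omega>. (X i \<omega>, Y i \<omega>)) {0..n} \<longrightarrow>
        (\<forall>i\<in>{1..n}. distr M borel (\<lambda>\<omega>. (X i \<omega>, Y i \<omega>)) = distr M borel (\<lambda>\<omega>. (X 0 \<omega>, Y 0 \<omega>))) \<longrightarrow>
        integrable M (\<lambda>\<omega>. (norm (X 0 \<omega>))\<^sup>2) \<longrightarrow>
        integrable M (\<lambda>\<omega>. (Y 0 \<omega>)\<^sup>2) \<longrightarrow>
        R > 0 \<longrightarrow>
        (AE \<omega> in M. norm (X 0 \<omega>) \<le> R) \<longrightarrow>
        lam \<ge> 2 * R\<^sup>2 / (real n + 1) \<longrightarrow>
        (\<forall>\<omega>\<in>space M. integrable M
            (\<lambda>\<omega>'. - ln (smp lam n (\<lambda>i. X i \<omega>) (\<lambda>i. Y i \<omega>) (X 0 \<omega>') (Y 0 \<omega>')))) \<and>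
        integrable M (\<lambda>\<omega>. risk M (X 0) (Y 0) (smp lam n (\<lambda>i. X i \<omega>) (\<lambda>i. Y i \<omega>))) \<and>
        (\<integral>\<omega>. risk M (X 0) (Y 0) (smp lam n (\<lambda>i. X i \<omega>) (\<lambda>i. Y i \<omega>)) \<partial>M)
          - (INF \<theta>. risk M (X 0) (Y 0) (gauss_model \<theta>) + lam / 2 * (norm \<theta>)\<^sup>2)
          \<le> 1.25 * (deg_freedom lam (cov_mat M (X 0)) / (real n + 1)))"
proof (intro conjI allI impI)
  fix X :: "nat \<Rightarrow> real ^ 'd" and Y :: "nat \<Rightarrow> real" and x y
  show "smp_well_defined lam n X Y x" by (rule smp_well_defined_pos[OF assms])
  show "smp_var lam n X x > 0" by (rule smp_var_pos[OF assms])
  show "smp lam n X Y x y = normal_dens (smp_mean lam n X Y x) (smp_var lam n X x) y"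
    by (rule smp_eq_normal_dens[OF assms])
next
  fix M :: "'w measure" and X :: "nat \<Rightarrow> 'w \<Rightarrow> real ^ 'd" and Y :: "nat \<Rightarrow> 'w \<Rightarrow> real" and R :: real
  assume M: "prob_space M"
    and sample: "prob_space.indep_vars M (\<lambda>_. borel) (\<lambda>i \<omega>. (X i \<omega>, Y i \<omega>)) {0..n}"
      "\<forall>i\<in>{1..n}. distr M borel (\<lambda>\<omega>. (X i \<omega>, Y i \<omega>)) = distr M borel (\<lambda>\<omega>. (X 0 \<omega>, Y 0 \<omega>))"
      "integrable M (\<lambda>\<omega>. (norm (X 0 \<omega>))\<^sup>2)" "integrable M (\<lambda>\<omega>. (Y 0 \<omega>)\<^sup>2)"
    and bounded: "AE \<omega> in M. norm (X 0 \<omega>) \<le> R" "lam \<ge> 2 * R\<^sup>2 / (real n + 1)"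
  interpret prob_space M by (rule M)
  interpret iid_sample M n X Y by standard (use sample in auto)
  show "\<forall>\<omega>\<in>space M. integrable M
      (\<lambda>\<omega>'. - ln (smp lam n (\<lambda>i. X i \<omega>) (\<lambda>i. Y i \<omega>) (X 0 \<omega>') (Y 0 \<omega>')))"
    by (intro ballI integrable_neg_ln_smp[OF assms bounded])
  show "integrable M (\<lambda>\<omega>. risk M (X 0) (Y 0) (smp lam n (\<lambda>i. X i \<omega>) (\<lambda>i. Y i \<omega>)))"
    by (rule integrable_smp_risk[OF assms bounded])
  \<comment> \<open>The risk bound holds for each \<theta>, so the left side is a lower bound of the
    family and hence at most its infimum.\<close>
  have "(\<integral>\<omega>. risk M (X 0) (Y 0) (smp lam n (\<lambda>i. X i \<omega>) (\<lambda>i. Y i \<omega>)) \<partial>M)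
        - 1.25 * (deg_freedom lam (cov_mat M (X 0)) / (real n + 1))
      \<le> (INF \<theta>. risk M (X 0) (Y 0) (gauss_model \<theta>) + lam / 2 * (norm \<theta>)\<^sup>2)"
    using expected_smp_risk_le[OF assms bounded] by (intro cINF_greatest) (auto simp: diff_le_eq)
  then show "(\<integral>\<omega>. risk M (X 0) (Y 0) (smp lam n (\<lambda>i. X i \<omega>) (\<lambda>i. Y i \<omega>)) \<partial>M)
      - (INF \<theta>. risk M (X 0) (Y 0) (gauss_model \<theta>) + lam / 2 * (norm \<theta>)\<^sup>2)
      \<le> 1.25 * (deg_freedom lam (cov_mat M (X 0)) / (real n + 1))"
    by linarith
qed

end
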